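(* Let $(\mathfrak{g}, \mathfrak{h}, \rho, \psi)$ be a matched pair of Lie algebras and $(V, W, \alpha, \beta)$ be a representation of it. Let $\mathrm{Ext}(\mathfrak{g},\mathfrak{h};V,W)$ be the set of isomorphism classes of abelian extensions of $(\mathfrak{g}, \mathfrak{h}, \rho, \psi)$ by the pair of vector spaces $(V,W)$ for which the induced representation is the given one. Then there is a bijection $$\mathrm{Ext} (\mathfrak{g}, \mathfrak{h}; V, W) \cong H^2_\mathrm{MPL} (\mathfrak{g}, \mathfrak{h}; V, W).$$
   Context: All vector spaces and (multi)linear maps are over a field $\mathbf{k}$ of characteristic zero. A matched pair of Lie algebras is a quadruple $(\mathfrak{g}, \mathfrak{h}, \rho, \psi)$ with $\mathfrak{g},\mathfrak{h}$ Lie algebras and bilinear maps $\rho : \mathfrak{g} \times \mathfrak{h} \to \mathfrak{h}$, $\psi : \mathfrak{h} \times \mathfrak{g} \to \mathfrak{g}$ such that $\rho$ is a representation of $\mathfrak{g}$ on $\mathfrak{h}$, $\psi$ is a representation of $\mathfrak{h}$ on $\mathfrak{g}$, and for all $x,y\in\mathfrak{g}$, $h,k\in\mathfrak{h}$: $$\rho_x ([h, k]_\mathfrak{h}) = [\rho_x h , k]_\mathfrak{h} + [h, \rho_x k]_\mathfrak{h} + \rho_{\psi_k x} h - \rho_{\psi_h x} k,$$ $$\psi_h ([x, y]_\mathfrak{g}) = [\psi_h x , y]_\mathfrak{g} + [x, \psi_h y]_\mathfrak{g} + \psi_{\rho_y h} x - \psi_{\rho_x h} y.$$ A morphism $(f,g)$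 to $(\mathfrak{g}',\mathfrak{h}',\rho',\psi')$, also written $f\Join g$, is a pair of Lie algebra homomorphisms $f:\mathfrak{g}\to\mathfrak{g}'$, $g:\mathfrak{h}\to\mathfrak{h}'$ with $g(\rho_xh)=\rho'_{f(x)}g(h)$, $f(\psi_hx)=\psi'_{g(h)}f(x)$. A representation of $(\mathfrak{g}, \mathfrak{h}, \rho, \psi)$ is a quadruple $(V,W,\alpha,\beta)$ in which $V$ and $W$ are each representations of both $\mathfrak{g}$ (actions $\rho_V,\rho_W$) and $\mathfrak{h}$ (actions $\psi_V,\psi_W$), and $\alpha: V \times \mathfrak{h} \to W$, $\beta: W \times \mathfrak{g} \to V$ are bilinear maps such that for all $x,y\in\mathfrak{g}$, $h,k\in\mathfrak{h}$, $v\in V$, $w\in W$: $$\alpha_{ (\rho_V)_x v} h = (\rho_W)_x \alpha_v h - \alpha_v \rho_x h,\qquad \beta_{ (\psi_W)_h w} x = (\psi_V)_h \beta_w x - \beta_w \psi_h x,$$ $$(\rho_W)_x (\psi_W)_h w = (\psi_W)_{\rho_x h} w + (\psi_W)_h (\rho_W)_x w + \alpha_{\beta_w x} h - (\rho_W)_{\psi_h x} w,$$ $$\alpha_v [h, k]_\mathfrak{h} = - (\psi_W)_k \alpha_v h + (\psi_W)_h \alpha_v k + \alpha_{ (\psi_V)_k v} h - \alpha_{ (\psi_V)_h v} k,$$ $$(\psi_V)_h (\rho_V)_x v = (\rho_V)_{\psi_h x} v + (\rho_V)_x (\psi_V)_h v + \beta_{\alpha_v h} x - (\psi_V)_{\rho_x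 h} v,$$ $$\beta_w [x, y]_\mathfrak{g} = - (\rho_V)_y \beta_w x + (\rho_V)_x \beta_w y + \beta_{ (\rho_W)_y w} x - \beta_{ (\rho_W)_x w } y.$$ Abelian extensions: regard $(V,W,0,0)$ as a matched pair with zero brackets. An abelian extension of $(\mathfrak{g},\mathfrak{h},\rho,\psi)$ by $(V,W)$ is a matched pair $(\widehat{\mathfrak{g}},\widehat{\mathfrak{h}},\widehat\rho,\widehat\psi)$ with morphisms of matched pairs $(i_1,i_2)$ from $(V,W,0,0)$ to it and $(j_1,j_2)$ from it to $(\mathfrak{g},\mathfrak{h},\rho,\psi)$ such that $0\to V\xrightarrow{i_1}\widehat{\mathfrak{g}}\xrightarrow{j_1}\mathfrak{g}\to0$ and $0\to W\xrightarrow{i_2}\widehat{\mathfrak{h}}\xrightarrow{j_2}\mathfrak{h}\to0$ are exact. Choosing linear sections $s_1$ of $j_1$ and $s_2$ of $j_2$, the induced representation on $(V,W)$ is (identifying $V$, $W$ with their images under $i_1,i_2$) $(\rho_V)_xv=[s_1(x),i_1(v)]_{\widehat{\mathfrak{g}}}$, $(\rho_W)_xw=\widehat\rho_{s_1(x)}i_2(w)$, $(\psi_V)_hv=\widehat\psi_{s_2(h)}i_1(v)$, $(\psi_W)_hw=[s_2(h),i_2(w)]_{\widehat{\mathfrak{h}}}$, $\alpha_vh=\widehat\rho_{i_1(v)}s_2(h)$, $\beta_wx=\widehat\psi_{i_2(w)}s_1(x)$; it does not depend on the sections. Two abelian extensions are isomorphic if there is an isomorphism $(f,g)$ of matched pairs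 $(\widehat{\mathfrak{g}},\widehat{\mathfrak{h}},\widehat\rho,\widehat\psi)\to(\widehat{\mathfrak{g}}',\widehat{\mathfrak{h}}',\widehat\rho',\widehat\psi')$ with $f i_1=i_1'$, $g i_2=i_2'$, $j_1'f=j_1$, $j_2'g=j_2$. Cohomology with coefficients: for $k,l\ge0$ let $C^{k|l}(\mathfrak{g},\mathfrak{h};V,W)=\mathrm{Hom}(\wedge^{k+1}\mathfrak{g}\otimes\wedge^l\mathfrak{h},V)\oplus\mathrm{Hom}(\wedge^k\mathfrak{g}\otimes\wedge^{l+1}\mathfrak{h},W)$, and for $n\ge1$ let $C^n(\mathfrak{g},\mathfrak{h};V,W)=C^{n-1|0}\oplus\cdots\oplus C^{0|n-1}$, viewed as a subspace of $\mathrm{Hom}(\wedge^n(\mathfrak{g}\oplus\mathfrak{h}),V\oplus W)$. Put $E=(\mathfrak{g}\oplus V)\oplus(\mathfrak{h}\oplus W)$ and let $\Pi:\wedge^2E\to E$ be $$\Pi\big((x,u,h,w),(y,v,k,w')\big)=\big([x,y]_\mathfrak{g}+\psi_hy-\psi_kx,\ (\rho_V)_xv-(\rho_V)_yu+(\psi_V)_hv+\beta_wy-(\psi_V)_ku-\beta_{w'}x,$$ $$[h,k]_\mathfrak{h}+\rho_xk-\rho_yh,\ (\psi_W)_hw'-(\psi_W)_kw+(\rho_W)_xw'+\alpha_uk-(\rho_W)_yw-\alpha_vh\big)$$ (the bicrossed product bracket of the semidirect product matched pair $(\mathfrak{g}\ltimes V,\mathfrak{h}\ltimes W,\rho\ltimes\alpha,\psi\ltimes\beta)$).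 Extend $F\in C^n(\mathfrak{g},\mathfrak{h};V,W)$ to a map $\wedge^nE\to E$ depending only on the $\mathfrak{g}\oplus\mathfrak{h}$-components of its arguments. Then $\delta_\mathrm{MPL}(F):=-[\Pi,F]_\mathrm{NR}$ is (the extension of) an element of $C^{n+1}(\mathfrak{g},\mathfrak{h};V,W)$, and $\delta_\mathrm{MPL}^2=0$. Here for $f\in\mathrm{Hom}(\wedge^{m+1}E,E)$, $g\in\mathrm{Hom}(\wedge^{n+1}E,E)$, $[f,g]_\mathrm{NR}=i_fg-(-1)^{mn}i_gf$ with $(i_f g)(z_1,\ldots,z_{m+n+1})=\sum_{\sigma\in\mathrm{Sh}(m+1,n)}(-1)^\sigma g(f(z_{\sigma(1)},\ldots,z_{\sigma(m+1)}),z_{\sigma(m+2)},\ldots,z_{\sigma(m+n+1)})$. Finally $H^2_\mathrm{MPL}(\mathfrak{g},\mathfrak{h};V,W)=\ker(\delta_\mathrm{MPL}:C^2\to C^3)/\mathrm{im}(\delta_\mathrm{MPL}:C^1\to C^2)$, where $C^1=\mathrm{Hom}(\mathfrak{g},V)\oplus\mathrm{Hom}(\mathfrak{h},W)$. *)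

theory Defs
  imports Complex_Main "HOL-Library.Product_Plus" "HOL-Combinatorics.Permutations"
begin

section \<open>Lie algebras on carrier sets\<close>

text \<open>
  The middle terms of an extension carry arbitrary vector space operations on arbitrary sets, so
  Lie algebras are records of explicit operations on a carrier. The scalars form a type of class
  \<open>field_char_0\<close>; values outside the carrier are irrelevant.
\<close>

record ('k, 'a) lie_data =
  carr :: "'a set"
  vadd :: "'a \<Rightarrow> 'a \<Rightarrow> 'a"
  vzero :: 'a
  vscale :: "'k \<Rightarrow> 'a \<Rightarrow> 'a"
  lbrack :: "'a \<Rightarrow> 'a \<Rightarrow> 'a"

definition vdiff :: "('k::field_char_0, 'a) lie_data \<Rightarrow> 'a \<Rightarrow> 'a \<Rightarrow> 'a" where
  "vdiff A x y = vadd A x (vscale A (- 1) y)"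

definition vector_space_on :: "('k::field_char_0, 'a) lie_data \<Rightarrow> bool" where
  "vector_space_on A \<longleftrightarrow>
     vzero A \<in> carr A \<and>
     (\<forall>x\<in>carr A. \<forall>y\<in>carr A. vadd A x y \<in> carr A) \<and>
     (\<forall>c. \<forall>x\<in>carr A. vscale A c x \<in> carr A) \<and>
     (\<forall>x\<in>carr A. \<forall>y\<in>carr A. \<forall>z\<in>carr A. vadd A (vadd A x y) z = vadd A x (vadd A y z)) \<and>
     (\<forall>x\<in>carr A. \<forall>y\<in>carr A. vadd A x y = vadd A y x) \<and>
     (\<forall>x\<in>carr A. vadd A (vzero A) x = x) \<and>
     (\<forall>x\<in>carr A. \<exists>y\<in>carr A. vadd A x y = vzero A) \<and>
     (\<forall>c. \<forall>x\<in>carr A. \<forall>y\<in>carr A. vscale A c (vadd A x y) = vadd A (vscale A c x) (vscale A c y)) \<and>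
     (\<forall>c d. \<forall>x\<in>carr A. vscale A (c + d) x = vadd A (vscale A c x) (vscale A d x)) \<and>
     (\<forall>c d. \<forall>x\<in>carr A. vscale A c (vscale A d x) = vscale A (c * d) x) \<and>
     (\<forall>x\<in>carr A. vscale A 1 x = x)"

definition linear_on :: "('k::field_char_0, 'a) lie_data \<Rightarrow> ('k, 'b) lie_data \<Rightarrow> ('a \<Rightarrow> 'b) \<Rightarrow> bool" where
  "linear_on A B f \<longleftrightarrow>
     (\<forall>x\<in>carr A. f x \<in> carr B) \<and>
     (\<forall>x\<in>carr A. \<forall>y\<in>carr A. f (vadd A x y) = vadd B (f x) (f y)) \<and>
     (\<forall>c. \<forall>x\<in>carr A. f (vscale A c x) = vscale B c (f x))"

definition bilinear_on ::
  "('k::field_char_0, 'a) lie_data \<Rightarrow> ('k, 'b) lie_data \<Rightarrow> ('k, 'c) lie_data \<Rightarrow> ('a \<Rightarrow> 'b \<Rightarrow> 'c) \<Rightarrow> bool" where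
  "bilinear_on A B C f \<longleftrightarrow>
     (\<forall>x\<in>carr A. linear_on B C (f x)) \<and> (\<forall>y\<in>carr B. linear_on A C (\<lambda>x. f x y))"

definition lie_algebra :: "('k::field_char_0, 'a) lie_data \<Rightarrow> bool" where
  "lie_algebra A \<longleftrightarrow>
     vector_space_on A \<and> bilinear_on A A A (lbrack A) \<and>
     (\<forall>x\<in>carr A. lbrack A x x = vzero A) \<and>
     (\<forall>x\<in>carr A. \<forall>y\<in>carr A. \<forall>z\<in>carr A.
        vadd A (lbrack A x (lbrack A y z))
          (vadd A (lbrack A y (lbrack A z x)) (lbrack A z (lbrack A x y))) = vzero A)"

definition lie_hom :: "('k::field_char_0, 'a) lie_data \<Rightarrow> ('k, 'b) lie_data \<Rightarrow> ('a \<Rightarrow> 'b) \<Rightarrow> bool" where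
  "lie_hom A B f \<longleftrightarrow>
     linear_on A B f \<and> (\<forall>x\<in>carr A. \<forall>y\<in>carr A. f (lbrack A x y) = lbrack B (f x) (f y))"

text \<open>Only the vector space underlying \<open>B\<close> matters here.\<close>

definition lie_rep :: "('k::field_char_0, 'a) lie_data \<Rightarrow> ('k, 'b) lie_data \<Rightarrow> ('a \<Rightarrow> 'b \<Rightarrow> 'b) \<Rightarrow> bool" where
  "lie_rep A B r \<longleftrightarrow>
     vector_space_on B \<and> bilinear_on A B B r \<and>
     (\<forall>x\<in>carr A. \<forall>y\<in>carr A. \<forall>b\<in>carr B.
        r (lbrack A x y) b = vdiff B (r x (r y b)) (r y (r x b)))"

text \<open>The carrier is the whole type, with the type's own addition.\<close>

definition on_type :: "('k::field_char_0, 'a::ab_group_add) lie_data \<Rightarrow> bool" where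
  "on_type A \<longleftrightarrow> carr A = UNIV \<and> vadd A = (+) \<and> vzero A = 0"

definition abelian_lie :: "('k::field_char_0 \<Rightarrow> 'a::ab_group_add \<Rightarrow> 'a) \<Rightarrow> ('k, 'a) lie_data" where
  "abelian_lie s = \<lparr>carr = UNIV, vadd = (+), vzero = 0, vscale = s, lbrack = (\<lambda>_ _. 0)\<rparr>"


section \<open>Matched pairs and their representations\<close>

record ('k, 'a, 'b) matched_pair_data =
  mpG :: "('k, 'a) lie_data"
  mpH :: "('k, 'b) lie_data"
  mprho :: "'a \<Rightarrow> 'b \<Rightarrow> 'b"
  mppsi :: "'b \<Rightarrow> 'a \<Rightarrow> 'a"

definition matched_pair :: "('k::field_char_0, 'a, 'b, 'm) matched_pair_data_scheme \<Rightarrow> bool" where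
  "matched_pair M \<longleftrightarrow>
     (let G = mpG M; H = mpH M; \<rho> = mprho M; \<psi> = mppsi M in
        lie_algebra G \<and> lie_algebra H \<and> lie_rep G H \<rho> \<and> lie_rep H G \<psi> \<and>
        (\<forall>x\<in>carr G. \<forall>h\<in>carr H. \<forall>k\<in>carr H.
           \<rho> x (lbrack H h k) =
             vdiff H (vadd H (vadd H (lbrack H (\<rho> x h) k) (lbrack H h (\<rho> x k))) (\<rho> (\<psi> k x) h))
               (\<rho> (\<psi> h x) k)) \<and>
        (\<forall>h\<in>carr H. \<forall>x\<in>carr G. \<forall>y\<in>carr G.
           \<psi> h (lbrack G x y) =
             vdiff G (vadd G (vadd G (lbrack G (\<psi> h x) y) (lbrack G x (\<psi> h y))) (\<psi> (\<rho> y h) x))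
               (\<psi> (\<rho> x h) y)))"

definition mp_hom ::
  "('k::field_char_0, 'a, 'b, 'm) matched_pair_data_scheme \<Rightarrow>
   ('k, 'c, 'd, 'n) matched_pair_data_scheme \<Rightarrow> ('a \<Rightarrow> 'c) \<Rightarrow> ('b \<Rightarrow> 'd) \<Rightarrow> bool" where
  "mp_hom M N f g \<longleftrightarrow>
     lie_hom (mpG M) (mpG N) f \<and> lie_hom (mpH M) (mpH N) g \<and>
     (\<forall>x\<in>carr (mpG M). \<forall>h\<in>carr (mpH M).
        g (mprho M x h) = mprho N (f x) (g h) \<and> f (mppsi M h x) = mppsi N (g h) (f x))"

definition mp_iso ::
  "('k::field_char_0, 'a, 'b, 'm) matched_pair_data_scheme \<Rightarrow>
   ('k, 'c, 'd, 'n) matched_pair_data_scheme \<Rightarrow> ('a \<Rightarrow> 'c) \<Rightarrow> ('b \<Rightarrow> 'd) \<Rightarrow> bool" where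
  "mp_iso M N f g \<longleftrightarrow>
     mp_hom M N f g \<and> bij_betw f (carr (mpG M)) (carr (mpG N)) \<and>
     bij_betw g (carr (mpH M)) (carr (mpH N))"

text \<open>The vector spaces \<open>V\<close>, \<open>W\<close> (given by their scalar multiplications), the four actions and
  \<open>\<alpha>\<close>, \<open>\<beta>\<close>.\<close>

record ('k, 'g, 'h, 'v, 'w) mp_rep_data =
  scaleV :: "'k \<Rightarrow> 'v \<Rightarrow> 'v"
  scaleW :: "'k \<Rightarrow> 'w \<Rightarrow> 'w"
  rhoV :: "'g \<Rightarrow> 'v \<Rightarrow> 'v"
  rhoW :: "'g \<Rightarrow> 'w \<Rightarrow> 'w"
  psiV :: "'h \<Rightarrow> 'v \<Rightarrow> 'v"
  psiW :: "'h \<Rightarrow> 'w \<Rightarrow> 'w"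
  rep_alpha :: "'v \<Rightarrow> 'h \<Rightarrow> 'w"
  rep_beta :: "'w \<Rightarrow> 'g \<Rightarrow> 'v"

definition mp_rep ::
  "('k::field_char_0, 'g::ab_group_add, 'h::ab_group_add) matched_pair_data \<Rightarrow>
   ('k, 'g, 'h, 'v::ab_group_add, 'w::ab_group_add) mp_rep_data \<Rightarrow> bool" where
  "mp_rep M R \<longleftrightarrow>
     (let G = mpG M; H = mpH M; \<rho> = mprho M; \<psi> = mppsi M;
          V = abelian_lie (scaleV R); W = abelian_lie (scaleW R);
          \<rho>V = rhoV R; \<rho>W = rhoW R; \<psi>V = psiV R; \<psi>W = psiW R; \<alpha> = rep_alpha R; \<beta> = rep_beta R in
        vector_space (scaleV R) \<and> vector_space (scaleW R) \<and>
        lie_rep G V \<rho>V \<and> lie_rep G W \<rho>W \<and> lie_rep H V \<psi>V \<and> lie_rep H W \<psi>W \<and>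
        bilinear_on V H W \<alpha> \<and> bilinear_on W G V \<beta> \<and>
        (\<forall>x\<in>carr G. \<forall>y\<in>carr G. \<forall>h\<in>carr H. \<forall>k\<in>carr H. \<forall>v w.
           \<alpha> (\<rho>V x v) h = \<rho>W x (\<alpha> v h) - \<alpha> v (\<rho> x h) \<and>
           \<beta> (\<psi>W h w) x = \<psi>V h (\<beta> w x) - \<beta> w (\<psi> h x) \<and>
           \<rho>W x (\<psi>W h w) = \<psi>W (\<rho> x h) w + \<psi>W h (\<rho>W x w) + \<alpha> (\<beta> w x) h - \<rho>W (\<psi> h x) w \<and>
           \<alpha> v (lbrack H h k) = - \<psi>W k (\<alpha> v h) + \<psi>W h (\<alpha> v k) + \<alpha> (\<psi>V k v) h - \<alpha> (\<psi>V h v) k \<and>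
           \<psi>V h (\<rho>V x v) = \<rho>V (\<psi> h x) v + \<rho>V x (\<psi>V h v) + \<beta> (\<alpha> v h) x - \<psi>V (\<rho> x h) v \<and>
           \<beta> w (lbrack G x y) = - \<rho>V y (\<beta> w x) + \<rho>V x (\<beta> w y) + \<beta> (\<rho>W y w) x - \<beta> (\<rho>W x w) y))"


section \<open>Abelian extensions\<close>

text \<open>An extension is a matched pair \<open>(mpG X, mpH X, mprho X, mppsi X)\<close> together with its
  inclusions and projections.\<close>

record ('k, 'a, 'b, 'g, 'h, 'v, 'w) extension_data = "('k, 'a, 'b) matched_pair_data" +
  incl1 :: "'v \<Rightarrow> 'a"
  incl2 :: "'w \<Rightarrow> 'b"
  proj1 :: "'a \<Rightarrow> 'g"
  proj2 :: "'b \<Rightarrow> 'h"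

definition abelian_mp ::
  "('k::field_char_0, 'g, 'h, 'v::ab_group_add, 'w::ab_group_add) mp_rep_data \<Rightarrow>
   ('k, 'v, 'w) matched_pair_data" where
  "abelian_mp R = \<lparr>mpG = abelian_lie (scaleV R), mpH = abelian_lie (scaleW R),
     mprho = (\<lambda>_ _. 0), mppsi = (\<lambda>_ _. 0)\<rparr>"

definition short_exact ::
  "('k::field_char_0, 'v) lie_data \<Rightarrow> ('k, 'a) lie_data \<Rightarrow> ('k, 'g) lie_data \<Rightarrow>
   ('v \<Rightarrow> 'a) \<Rightarrow> ('a \<Rightarrow> 'g) \<Rightarrow> bool" where
  "short_exact V A G i j \<longleftrightarrow>
     inj_on i (carr V) \<and> i ` carr V = {a \<in> carr A. j a = vzero G} \<and> j ` carr A = carr G"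

definition abelian_extension ::
  "('k::field_char_0, 'g::ab_group_add, 'h::ab_group_add) matched_pair_data \<Rightarrow>
   ('k, 'g, 'h, 'v::ab_group_add, 'w::ab_group_add) mp_rep_data \<Rightarrow>
   ('k, 'a, 'b, 'g, 'h, 'v, 'w) extension_data \<Rightarrow> bool" where
  "abelian_extension M R X \<longleftrightarrow>
     matched_pair X \<and>
     mp_hom (abelian_mp R) X (incl1 X) (incl2 X) \<and> mp_hom X M (proj1 X) (proj2 X) \<and>
     short_exact (mpG (abelian_mp R)) (mpG X) (mpG M) (incl1 X) (proj1 X) \<and>
     short_exact (mpH (abelian_mp R)) (mpH X) (mpH M) (incl2 X) (proj2 X)"

definition linear_section ::
  "('k::field_char_0, 'a) lie_data \<Rightarrow> ('k, 'g) lie_data \<Rightarrow> ('a \<Rightarrow> 'g) \<Rightarrow> ('g \<Rightarrow> 'a) \<Rightarrow> bool" where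
  "linear_section A G j s \<longleftrightarrow> linear_on G A s \<and> (\<forall>x\<in>carr G. j (s x) = x)"

text \<open>The representation induced on \<open>(V, W)\<close> by \<open>X\<close> is the one recorded in \<open>R\<close>. It does not depend
  on the sections, which exist because all linear maps are over a field.\<close>

definition induces_rep ::
  "('k::field_char_0, 'g::ab_group_add, 'h::ab_group_add) matched_pair_data \<Rightarrow>
   ('k, 'g, 'h, 'v::ab_group_add, 'w::ab_group_add) mp_rep_data \<Rightarrow>
   ('k, 'a, 'b, 'g, 'h, 'v, 'w) extension_data \<Rightarrow> bool" where
  "induces_rep M R X \<longleftrightarrow>
     (\<exists>s1 s2. linear_section (mpG X) (mpG M) (proj1 X) s1 \<and>
        linear_section (mpH X) (mpH M) (proj2 X) s2 \<and>
        (\<forall>x\<in>carr (mpG M). \<forall>h\<in>carr (mpH M). \<forall>v w.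
           incl1 X (rhoV R x v) = lbrack (mpG X) (s1 x) (incl1 X v) \<and>
           incl2 X (rhoW R x w) = mprho X (s1 x) (incl2 X w) \<and>
           incl1 X (psiV R h v) = mppsi X (s2 h) (incl1 X v) \<and>
           incl2 X (psiW R h w) = lbrack (mpH X) (s2 h) (incl2 X w) \<and>
           incl2 X (rep_alpha R v h) = mprho X (incl1 X v) (s2 h) \<and>
           incl1 X (rep_beta R w x) = mppsi X (incl2 X w) (s1 x)))"

definition isomorphic_ext ::
  "('k::field_char_0, 'a, 'b, 'g, 'h, 'v, 'w) extension_data \<Rightarrow>
   ('k, 'a, 'b, 'g, 'h, 'v, 'w) extension_data \<Rightarrow> bool" where
  "isomorphic_ext X Y \<longleftrightarrow>
     (\<exists>f g. mp_iso X Y f g \<and>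
        (\<forall>v. f (incl1 X v) = incl1 Y v) \<and> (\<forall>w. g (incl2 X w) = incl2 Y w) \<and>
        (\<forall>a\<in>carr (mpG X). proj1 Y (f a) = proj1 X a) \<and>
        (\<forall>b\<in>carr (mpH X). proj2 Y (g b) = proj2 X b))"

definition extensions ::
  "('k::field_char_0, 'g::ab_group_add, 'h::ab_group_add) matched_pair_data \<Rightarrow>
   ('k, 'g, 'h, 'v::ab_group_add, 'w::ab_group_add) mp_rep_data \<Rightarrow>
   ('k, 'a, 'b, 'g, 'h, 'v, 'w) extension_data set" where
  "extensions M R = {X. abelian_extension M R X \<and> induces_rep M R X}"

text \<open>Isomorphism classes, among the extensions whose carriers are subsets of \<open>'a\<close> and \<open>'b\<close>.
  Every extension of \<open>M\<close> by \<open>(V, W)\<close> has carriers in bijection with \<open>'g \<times> 'v\<close> and \<open>'h \<times> 'w\<close>, so no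
  class is missing once these types inject into \<open>'a\<close> and \<open>'b\<close>.\<close>

definition Ext ::
  "('k::field_char_0, 'g::ab_group_add, 'h::ab_group_add) matched_pair_data \<Rightarrow>
   ('k, 'g, 'h, 'v::ab_group_add, 'w::ab_group_add) mp_rep_data \<Rightarrow>
   ('k, 'a, 'b, 'g, 'h, 'v, 'w) extension_data set set" where
  "Ext M R = extensions M R // {(X, Y). X \<in> extensions M R \<and> Y \<in> extensions M R \<and> isomorphic_ext X Y}"


section \<open>Cohomology\<close>

text \<open>
  A map of \<open>n\<close> arguments is a function on lists. \<open>shuffles_set p q\<close> is \<open>Sh(p, q)\<close>, with positions
  counted from \<open>0\<close>.
\<close>

definition shuffles_set :: "nat \<Rightarrow> nat \<Rightarrow> (nat \<Rightarrow> nat) set" where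
  "shuffles_set p q = {\<sigma>. \<sigma> permutes {..<p + q} \<and>
     strict_mono_on {..<p} \<sigma> \<and> strict_mono_on {p..<p + q} \<sigma>}"

definition signed :: "(nat \<Rightarrow> nat) \<Rightarrow> 'a::ab_group_add \<Rightarrow> 'a" where
  "signed \<sigma> z = (if evenperm \<sigma> then z else - z)"

definition pick :: "(nat \<Rightarrow> nat) \<Rightarrow> nat \<Rightarrow> nat \<Rightarrow> 'a list \<Rightarrow> 'a list" where
  "pick \<sigma> a b zs = map (\<lambda>i. zs ! \<sigma> i) [a..<b]"

text \<open>\<open>insertion m n f g\<close> is \<open>i\<^sub>f g\<close> for \<open>f\<close> of \<open>m + 1\<close> and \<open>g\<close> of \<open>n + 1\<close> arguments.\<close>

definition insertion ::
  "nat \<Rightarrow> nat \<Rightarrow> ('e list \<Rightarrow> 'e) \<Rightarrow> ('e list \<Rightarrow> 'e) \<Rightarrow> 'e list \<Rightarrow> 'e::ab_group_add" where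
  "insertion m n f g zs =
     (if length zs = m + n + 1
      then \<Sum>\<sigma>\<in>shuffles_set (m + 1) n.
        signed \<sigma> (g (f (pick \<sigma> 0 (m + 1) zs) # pick \<sigma> (m + 1) (m + n + 1) zs))
      else 0)"

definition nr_bracket ::
  "nat \<Rightarrow> nat \<Rightarrow> ('e list \<Rightarrow> 'e) \<Rightarrow> ('e list \<Rightarrow> 'e) \<Rightarrow> 'e list \<Rightarrow> 'e::ab_group_add" where
  "nr_bracket m n f g zs =
     insertion m n f g zs - (if even (m * n) then insertion n m g f zs else - insertion n m g f zs)"

text \<open>\<open>Hom(\<And>\<^sup>p \<gg> \<otimes> \<And>\<^sup>q \<hh>, U)\<close> as maps of \<open>p + q\<close> arguments; values on lists of other lengths are
  arbitrary and never used.\<close>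

definition alt_hom ::
  "('k::field_char_0 \<Rightarrow> 'g::ab_group_add \<Rightarrow> 'g) \<Rightarrow> ('k \<Rightarrow> 'h::ab_group_add \<Rightarrow> 'h) \<Rightarrow>
   ('k \<Rightarrow> 'u::ab_group_add \<Rightarrow> 'u) \<Rightarrow> nat \<Rightarrow> nat \<Rightarrow> ('g list \<Rightarrow> 'h list \<Rightarrow> 'u) set" where
  "alt_hom sg sh su p q = {A. \<forall>xs ys. length xs = p \<and> length ys = q \<longrightarrow>
     (\<forall>i<p. Vector_Spaces.linear sg su (\<lambda>x. A (xs[i := x]) ys)) \<and>
     (\<forall>j<q. Vector_Spaces.linear sh su (\<lambda>y. A xs (ys[j := y]))) \<and>
     (\<forall>i<p. \<forall>j<p. i \<noteq> j \<and> xs ! i = xs ! j \<longrightarrow> A xs ys = 0) \<and>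
     (\<forall>i<q. \<forall>j<q. i \<noteq> j \<and> ys ! i = ys ! j \<longrightarrow> A xs ys = 0)}"

text \<open>The standard embedding of \<open>Hom(\<And>\<^sup>p \<gg> \<otimes> \<And>\<^sup>q \<hh>, U)\<close> into \<open>Hom(\<And>\<^sup>p\<^sup>+\<^sup>q (\<gg> \<oplus> \<hh>), U)\<close>: the
  result agrees with \<open>A\<close> on \<open>p\<close> elements of \<open>\<gg>\<close> followed by \<open>q\<close> elements of \<open>\<hh>\<close>, and vanishes on
  homogeneous arguments of any other type.\<close>

definition lift_hom ::
  "nat \<Rightarrow> nat \<Rightarrow> ('g list \<Rightarrow> 'h list \<Rightarrow> 'u::ab_group_add) \<Rightarrow> ('g \<times> 'h) list \<Rightarrow> 'u" where
  "lift_hom p q A zs =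
     (if length zs = p + q
      then \<Sum>\<sigma>\<in>shuffles_set p q.
        signed \<sigma> (A (map fst (pick \<sigma> 0 p zs)) (map snd (pick \<sigma> p (p + q) zs)))
      else 0)"

type_synonym ('g, 'h, 'v, 'w) total = "('g \<times> 'v) \<times> ('h \<times> 'w)"

text \<open>Extension of a map on \<open>\<gg> \<oplus> \<hh>\<close> with components in \<open>V\<close> and \<open>W\<close> to \<open>E\<close>.\<close>

definition extend ::
  "(('g \<times> 'h) list \<Rightarrow> 'v) \<Rightarrow> (('g \<times> 'h) list \<Rightarrow> 'w) \<Rightarrow>
   ('g::zero, 'h::zero, 'v, 'w) total list \<Rightarrow> ('g, 'h, 'v, 'w) total" where
  "extend FV FW zs =
     (let ys = map (\<lambda>((x, u), (h, w)). (x, h)) zs in ((0, FV ys), (0, FW ys)))"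

text \<open>\<open>C\<^sup>n = \<Oplus>\<^bsub>k+l=n-1\<^esub> C\<^sup>k\<^sup>|\<^sup>l\<close> for \<open>n \<ge> 1\<close>, its elements being extended to \<open>E\<close>.\<close>

definition cochains ::
  "('k::field_char_0, 'g::ab_group_add, 'h::ab_group_add) matched_pair_data \<Rightarrow>
   ('k, 'g, 'h, 'v::ab_group_add, 'w::ab_group_add) mp_rep_data \<Rightarrow> nat \<Rightarrow>
   (('g, 'h, 'v, 'w) total list \<Rightarrow> ('g, 'h, 'v, 'w) total) set" where
  "cochains M R n =
     {extend (\<lambda>zs. \<Sum>k<n. lift_hom (k + 1) (n - 1 - k) (A k) zs)
             (\<lambda>zs. \<Sum>k<n. lift_hom k (n - 1 - k + 1) (B k) zs) | A B.
      \<forall>k<n. A k \<in> alt_hom (vscale (mpG M)) (vscale (mpH M)) (scaleV R) (k + 1) (n - 1 - k) \<and>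
            B k \<in> alt_hom (vscale (mpG M)) (vscale (mpH M)) (scaleW R) k (n - 1 - k + 1)}"

definition total_bracket ::
  "('k::field_char_0, 'g::ab_group_add, 'h::ab_group_add) matched_pair_data \<Rightarrow>
   ('k, 'g, 'h, 'v::ab_group_add, 'w::ab_group_add) mp_rep_data \<Rightarrow>
   ('g, 'h, 'v, 'w) total \<Rightarrow> ('g, 'h, 'v, 'w) total \<Rightarrow> ('g, 'h, 'v, 'w) total" where
  "total_bracket M R = (\<lambda>((x, u), (h, w)) ((y, v), (k, w')).
     ((lbrack (mpG M) x y + mppsi M h y - mppsi M k x,
       rhoV R x v - rhoV R y u + psiV R h v + rep_beta R w y - psiV R k u - rep_beta R w' x),
      (lbrack (mpH M) h k + mprho M x k - mprho M y h,
       psiW R h w' - psiW R k w + rhoW R x w' + rep_alpha R u k - rhoW R y w - rep_alpha R v h)))"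

definition Pi_map ::
  "('k::field_char_0, 'g::ab_group_add, 'h::ab_group_add) matched_pair_data \<Rightarrow>
   ('k, 'g, 'h, 'v::ab_group_add, 'w::ab_group_add) mp_rep_data \<Rightarrow>
   ('g, 'h, 'v, 'w) total list \<Rightarrow> ('g, 'h, 'v, 'w) total" where
  "Pi_map M R zs = (if length zs = 2 then total_bracket M R (zs ! 0) (zs ! 1) else 0)"

text \<open>The coboundary of cochains of \<open>n \<ge> 1\<close> arguments.\<close>

definition delta_MPL ::
  "('k::field_char_0, 'g::ab_group_add, 'h::ab_group_add) matched_pair_data \<Rightarrow>
   ('k, 'g, 'h, 'v::ab_group_add, 'w::ab_group_add) mp_rep_data \<Rightarrow> nat \<Rightarrow>
   (('g, 'h, 'v, 'w) total list \<Rightarrow> ('g, 'h, 'v, 'w) total) \<Rightarrow>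
   ('g, 'h, 'v, 'w) total list \<Rightarrow> ('g, 'h, 'v, 'w) total" where
  "delta_MPL M R n F = (\<lambda>zs. - nr_bracket 1 (n - 1) (Pi_map M R) F zs)"

definition cocycles2 ::
  "('k::field_char_0, 'g::ab_group_add, 'h::ab_group_add) matched_pair_data \<Rightarrow>
   ('k, 'g, 'h, 'v::ab_group_add, 'w::ab_group_add) mp_rep_data \<Rightarrow>
   (('g, 'h, 'v, 'w) total list \<Rightarrow> ('g, 'h, 'v, 'w) total) set" where
  "cocycles2 M R = {F \<in> cochains M R 2. delta_MPL M R 2 F = (\<lambda>_. 0)}"

definition H2_MPL ::
  "('k::field_char_0, 'g::ab_group_add, 'h::ab_group_add) matched_pair_data \<Rightarrow>
   ('k, 'g, 'h, 'v::ab_group_add, 'w::ab_group_add) mp_rep_data \<Rightarrow>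
   (('g, 'h, 'v, 'w) total list \<Rightarrow> ('g, 'h, 'v, 'w) total) set set" where
  "H2_MPL M R = cocycles2 M R // {(F, F'). F \<in> cocycles2 M R \<and> F' \<in> cocycles2 M R \<and>
     (\<lambda>zs. F zs - F' zs) \<in> delta_MPL M R 1 ` cochains M R 1}"

end

theory Submission
  imports Defs
begin

text \<open>
  Linear sections identify the carriers of an extension with \<open>\<gg> \<times> V\<close> and \<open>\<hh> \<times> W\<close>. Its structure then
  differs from the semidirect product by four bilinear maps
  \<open>a : \<gg> \<times> \<gg> \<rightarrow> V\<close>, \<open>b : \<gg> \<times> \<hh> \<rightarrow> V\<close>, \<open>c : \<gg> \<times> \<hh> \<rightarrow> W\<close>, \<open>d : \<hh> \<times> \<hh> \<rightarrow> W\<close>, which are the data of a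
  \<open>2\<close>-cochain \<open>F\<close>. The bicrossed product bracket of the twisted structure is \<open>\<Pi> + F\<close>, and since
  \<open>F\<close> composed with itself vanishes, the matched pair axioms say exactly that \<open>F\<close> is a cocycle.
  An isomorphism of twisted structures over the identity has the form \<open>(x, u) \<mapsto> (x, u + p x)\<close>,
  \<open>(h, w) \<mapsto> (h, w + q h)\<close>, and it exists iff the cocycles differ by the coboundary of \<open>(p, q)\<close>.
\<close>

text \<open>Neither direction of the correspondence is a canonical map. An extension yields a
  cocycle only after sections are chosen. A cocycle yields a twisted product on product types,
  whereas the members of \<open>Ext\<close> live on subsets of \<open>'a\<close> and
  \<open>'b\<close>, so a carrier must be chosen as well. The two quotients are therefore matched
  through a relation, \<open>realises\<close>. The square of \<open>F\<close> vanishes because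
  \<open>F\<close> takes values in \<open>V \<oplus> W\<close> and ignores the \<open>V\<close>- and
  \<open>W\<close>-components of its arguments. The defect of the matched pair axioms is thus affine
  in \<open>F\<close>; its constant part is zero by the representation axioms, and its linear part
  is the coboundary up to sign. This comparison does not go through an abstract equivalence between
  matched pairs and Jacobi identities of bicrossed products. Axioms and coboundary are both
  expressed by the same six maps \<open>coc1\<close> to \<open>coc6\<close>, one for each of the six
  Hom spaces that make up \<open>C^3\<close>, and are compared there.\<close>

section \<open>Quotients matched by a relation\<close>

text \<open>Choose \<open>p\<close> and \<open>e\<close> inside \<open>P\<close>, one in each
  direction. Compatibility makes \<open>s\<close> the preimage of \<open>r\<close> under
  \<open>e\<close>, so \<open>s\<close> inherits the equivalence laws; in the application this is
  how being cohomologous becomes an equivalence relation. The class of \<open>p a\<close> then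
  depends only on the class of \<open>a\<close>.\<close>

lemma quotient_bij_betw_of_relation:
  assumes r: "equiv A r" and s: "s \<subseteq> B \<times> B"
    and tot: "\<And>a. a \<in> A \<Longrightarrow> \<exists>b\<in>B. P b a"
    and sur: "\<And>b. b \<in> B \<Longrightarrow> \<exists>a\<in>A. P b a"
    and compat: "\<And>a a' b b'. \<lbrakk>a \<in> A; a' \<in> A; b \<in> B; b' \<in> B; P b a; P b' a'\<rbrakk>
      \<Longrightarrow> (a, a') \<in> r \<longleftrightarrow> (b, b') \<in> s"
  shows "\<exists>\<Phi>. bij_betw \<Phi> (A // r) (B // s)"
proof -
  obtain p where p: "\<And>a. a \<in> A \<Longrightarrow> p a \<in> B \<and> P (p a) a"
    using tot by metis
  obtain e where e: "\<And>b. b \<in> B \<Longrightarrow> e b \<in> A \<and> P b (e b)"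
    using sur by metis
  have e_iff: "(b, b') \<in> s \<longleftrightarrow> (e b, e b') \<in> r" if "b \<in> B" "b' \<in> B" for b b'
    using compat that e by blast
  have s_eq: "s = {(b, b'). b \<in> B \<and> b' \<in> B \<and> (e b, e b') \<in> r}"
    using s e_iff by blast
  have "refl_on A r" "sym r" "trans r"
    using r by (auto elim: equivE)
  then have s: "equiv B s"
    using e unfolding s_eq
    by (intro equivI) (auto simp: refl_on_def intro!: symI transI dest: symD transD)
  have iff: "(a, a') \<in> r \<longleftrightarrow> (p a, p a') \<in> s" if "a \<in> A" "a' \<in> A" for a a'
    using compat that p by blast
  define \<Phi> where "\<Phi> C = s `` (p ` C)" for C
  have \<Phi>: "\<Phi> (r `` {a}) = s `` {p a}" if "a \<in> A" for a
  proof -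
    have "s `` {p a'} = s `` {p a}" if aa': "(a, a') \<in> r" for a'
    proof -
      have "a' \<in> A" using aa' r by (simp add: equiv_class_eq_iff)
      then have "(p a, p a') \<in> s" using iff \<open>a \<in> A\<close> aa' by blast
      then show ?thesis using equiv_class_eq[OF s] by blast
    qed
    moreover have "(a, a) \<in> r"
      using r that by (simp add: equiv_class_eq_iff)
    ultimately show ?thesis
      unfolding \<Phi>_def by blast
  qed
  have "inj_on \<Phi> (A // r)"
  proof (rule inj_onI)
    fix C C' assume "C \<in> A // r" "C' \<in> A // r" and eq: "\<Phi> C = \<Phi> C'"
    then obtain a a' where a: "a \<in> A" "C = r `` {a}" "a' \<in> A" "C' = r `` {a'}"
      by (metis quotientE)
    then have "(p a, p a') \<in> s"
      using eq \<Phi> p eq_equiv_class_iff[OF s] by metis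
    then show "C = C'"
      using a iff equiv_class_eq[OF r] by metis
  qed
  moreover have "\<Phi> ` (A // r) = B // s"
  proof (intro equalityI subsetI)
    fix D assume "D \<in> \<Phi> ` (A // r)"
    then obtain a where "a \<in> A" "D = s `` {p a}"
      using \<Phi> by (auto elim!: quotientE)
    then show "D \<in> B // s"
      using p by (auto intro: quotientI)
  next
    fix D assume "D \<in> B // s"
    then obtain b where b: "b \<in> B" "D = s `` {b}"
      by (auto elim: quotientE)
    have "(e b, e b) \<in> r"
      using r e b by (simp add: equiv_class_eq_iff)
    \<comment> \<open>Both \<open>p (e b)\<close> and \<open>b\<close> are \<open>P\<close>-related
      to \<open>e b\<close>, so reflexivity of \<open>r\<close> at \<open>e b\<close> identifies
      their classes.\<close>
    then have "(p (e b), b) \<in> s"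
      using compat e b p by blast
    then have "D = \<Phi> (r `` {e b})"
      using \<Phi> e b equiv_class_eq[OF s] by metis
    then show "D \<in> \<Phi> ` (A // r)"
      using e b by (auto intro: quotientI)
  qed
  ultimately show ?thesis
    unfolding bij_betw_def by blast
qed

section \<open>Vector spaces on carrier sets\<close>

lemma vector_space_onD:
  assumes "vector_space_on A"
  shows "vzero A \<in> carr A"
    and "x \<in> carr A \<Longrightarrow> y \<in> carr A \<Longrightarrow> vadd A x y \<in> carr A"
    and "x \<in> carr A \<Longrightarrow> vscale A t x \<in> carr A"
    and "x \<in> carr A \<Longrightarrow> y \<in> carr A \<Longrightarrow> z \<in> carr A \<Longrightarrow> vadd A (vadd A x y) z = vadd A x (vadd A y z)"
    and "x \<in> carr A \<Longrightarrow> y \<in> carr A \<Longrightarrow> vadd A x y = vadd A y x"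
    and "x \<in> carr A \<Longrightarrow> vadd A (vzero A) x = x"
    and "x \<in> carr A \<Longrightarrow> \<exists>y\<in>carr A. vadd A x y = vzero A"
    and "x \<in> carr A \<Longrightarrow> vscale A (t + t') x = vadd A (vscale A t x) (vscale A t' x)"
  using assms unfolding vector_space_on_def by metis+

lemma vector_space_on_left_comm:
  assumes "vector_space_on A" "x \<in> carr A" "y \<in> carr A" "z \<in> carr A"
  shows "vadd A x (vadd A y z) = vadd A y (vadd A x z)"
  using vector_space_onD(4,5)[OF assms(1)] assms(2-4) by metis

section \<open>Transport of structure\<close>

text \<open>For a bijection \<open>f\<close> from \<open>C\<close> onto the carrier of
  \<open>A\<close>, this is the structure on \<open>C\<close> that makes \<open>f\<close> an
  isomorphism. It serves in both directions of the proof: to give an arbitrary extension the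
  carriers \<open>\<gg> \<times> V\<close> and \<open>\<hh> \<times> W\<close>, and to place a
  twisted product inside \<open>'a\<close> and \<open>'b\<close>.\<close>

definition pull_lie :: "'c set \<Rightarrow> ('c \<Rightarrow> 'a) \<Rightarrow> ('k, 'a) lie_data \<Rightarrow> ('k, 'c) lie_data" where
  "pull_lie C f A = \<lparr>carr = C,
     vadd = (\<lambda>x y. inv_into C f (vadd A (f x) (f y))),
     vzero = inv_into C f (vzero A),
     vscale = (\<lambda>t x. inv_into C f (vscale A t (f x))),
     lbrack = (\<lambda>x y. inv_into C f (lbrack A (f x) (f y)))\<rparr>"

lemma pull_lie_simps [simp]:
  "carr (pull_lie C f A) = C"
  "vadd (pull_lie C f A) x y = inv_into C f (vadd A (f x) (f y))"
  "vzero (pull_lie C f A) = inv_into C f (vzero A)"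
  "vscale (pull_lie C f A) t x = inv_into C f (vscale A t (f x))"
  "lbrack (pull_lie C f A) x y = inv_into C f (lbrack A (f x) (f y))"
  by (simp_all add: pull_lie_def)

lemma vdiff_pull_lie:
  assumes "vector_space_on A" "bij_betw f C (carr A)" "x \<in> C" "y \<in> C"
  shows "vdiff (pull_lie C f A) x y = inv_into C f (vdiff A (f x) (f y))"
  using assms
  by (simp add: vdiff_def vector_space_on_def bij_betw_inv_into_right bij_betwE)

lemma vector_space_on_pull_lie:
  assumes "vector_space_on A" and f: "bij_betw f C (carr A)"
  shows "vector_space_on (pull_lie C f A)"
proof -
  have fC [simp]: "f x \<in> carr A" if "x \<in> C" for x using that f by (auto simp: bij_betw_def)
  have [simp]: "inv_into C f y \<in> C" "f (inv_into C f y) = y" if "y \<in> carr A" for y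
    using that f by (auto simp: bij_betw_def inv_into_into f_inv_into_f)
  have [simp]: "inv_into C f (f x) = x" if "x \<in> C" for x
    using that f by (auto simp: bij_betw_def)
  have inv: "\<exists>y\<in>C. inv_into C f (vadd A (f x) (f y)) = inv_into C f (vzero A)" if "x \<in> C" for x
  proof -
    obtain b where "b \<in> carr A" "vadd A (f x) b = vzero A"
      using assms(1) \<open>x \<in> C\<close> unfolding vector_space_on_def by (metis fC)
    then show ?thesis by (intro bexI[of _ "inv_into C f b"]) simp_all
  qed
  show ?thesis
    using assms(1) inv vector_space_on_left_comm[OF assms(1)] unfolding vector_space_on_def
    by simp
qed

lemma bilinear_on_pull_lie:
  assumes r: "bilinear_on A B D r"
    and f: "bij_betw f C (carr A)" and g: "bij_betw g C' (carr B)" and h: "bij_betw h C'' (carr D)"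
    and vs: "vector_space_on A" "vector_space_on B" "vector_space_on D"
  shows "bilinear_on (pull_lie C f A) (pull_lie C' g B) (pull_lie C'' h D)
    (\<lambda>x y. inv_into C'' h (r (f x) (g y)))"
proof -
  have [simp]: "f x \<in> carr A" if "x \<in> C" for x using that f by (auto simp: bij_betw_def)
  have [simp]: "f (inv_into C f y) = y" if "y \<in> carr A" for y
    using that f by (auto simp: bij_betw_def f_inv_into_f)
  have [simp]: "g x \<in> carr B" if "x \<in> C'" for x using that g by (auto simp: bij_betw_def)
  have [simp]: "g (inv_into C' g y) = y" if "y \<in> carr B" for y
    using that g by (auto simp: bij_betw_def f_inv_into_f)
  have [simp]: "inv_into C'' h y \<in> C''" "h (inv_into C'' h y) = y" if "y \<in> carr D" for y
    using that h by (auto simp: bij_betw_def inv_into_into f_inv_into_f)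
  show ?thesis
    using r vs unfolding bilinear_on_def linear_on_def vector_space_on_def by simp
qed

lemma lie_algebra_pull_lie:
  assumes A: "lie_algebra A" and f: "bij_betw f C (carr A)"
  shows "lie_algebra (pull_lie C f A)"
proof -
  have vs: "vector_space_on A" and bil: "bilinear_on A A A (lbrack A)"
    using A by (auto simp: lie_algebra_def)
  have [simp]: "f x \<in> carr A" if "x \<in> C" for x using that f by (auto simp: bij_betw_def)
  have [simp]: "f (inv_into C f y) = y" if "y \<in> carr A" for y
    using that f by (auto simp: bij_betw_def f_inv_into_f)
  have [simp]: "vadd A x y \<in> carr A" "lbrack A x y \<in> carr A" if "x \<in> carr A" "y \<in> carr A" for x y
    using that vs bil by (auto simp: vector_space_on_def bilinear_on_def linear_on_def)
  have "lbrack (pull_lie C f A) = (\<lambda>x y. inv_into C f (lbrack A (f x) (f y)))"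
    by (simp add: pull_lie_def)
  then show ?thesis
    using A bilinear_on_pull_lie[OF bil f f f vs vs vs]
    by (simp add: lie_algebra_def vector_space_on_pull_lie[OF vs f])
qed

lemma lie_rep_pull_lie:
  assumes r: "lie_rep A B r" and A: "lie_algebra A"
    and f: "bij_betw f C (carr A)" and g: "bij_betw g D (carr B)"
  shows "lie_rep (pull_lie C f A) (pull_lie D g B) (\<lambda>x y. inv_into D g (r (f x) (g y)))"
proof -
  have vs: "vector_space_on A" and bil: "bilinear_on A A A (lbrack A)"
    using A by (auto simp: lie_algebra_def)
  have vsB: "vector_space_on B" and bilr: "bilinear_on A B B r"
    using r by (auto simp: lie_rep_def)
  have [simp]: "f x \<in> carr A" if "x \<in> C" for x using that f by (auto simp: bij_betw_def)
  have [simp]: "f (inv_into C f y) = y" if "y \<in> carr A" for y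
    using that f by (auto simp: bij_betw_def f_inv_into_f)
  have [simp]: "g x \<in> carr B" if "x \<in> D" for x using that g by (auto simp: bij_betw_def)
  have [simp]: "inv_into D g y \<in> D" "g (inv_into D g y) = y" if "y \<in> carr B" for y
    using that g by (auto simp: bij_betw_def inv_into_into f_inv_into_f)
  have [simp]: "lbrack A x y \<in> carr A" if "x \<in> carr A" "y \<in> carr A" for x y
    using that bil by (auto simp: bilinear_on_def linear_on_def)
  have [simp]: "r x y \<in> carr B" if "x \<in> carr A" "y \<in> carr B" for x y
    using that bilr by (auto simp: bilinear_on_def linear_on_def)
  show ?thesis
    using r bilinear_on_pull_lie[OF bilr f g g vs vsB vsB]
    by (simp add: lie_rep_def vector_space_on_pull_lie[OF vsB g] vdiff_pull_lie[OF vsB g])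
qed

lemma short_exact_pull_lie:
  assumes ex: "short_exact V A G i j" and f: "bij_betw f C (carr A)"
  shows "short_exact V (pull_lie C f A) G (\<lambda>v. inv_into C f (i v)) (\<lambda>x. j (f x))"
proof -
  have iV: "i ` carr V = {a \<in> carr A. j a = vzero G}"
    using ex by (simp add: short_exact_def)
  have "inj_on (inv_into C f \<circ> i) (carr V)"
    using ex iV bij_betw_imp_inj_on[OF bij_betw_inv_into[OF f]]
    by (auto simp: short_exact_def intro!: comp_inj_on intro: inj_on_subset)
  moreover have "inv_into C f ` (i ` carr V) = {a \<in> C. j (f a) = vzero G}"
    unfolding iV
  proof (intro equalityI subsetI)
    fix x assume "x \<in> {a \<in> C. j (f a) = vzero G}"
    then show "x \<in> inv_into C f ` {a \<in> carr A. j a = vzero G}"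
      using f by (intro image_eqI[of _ _ "f x"]) (auto simp: bij_betw_def)
  qed (use f in \<open>auto simp: bij_betw_def inv_into_into f_inv_into_f\<close>)
  moreover have "(j \<circ> f) ` C = carr G"
    using ex f by (metis bij_betw_imp_surj_on image_comp short_exact_def)
  ultimately show ?thesis
    by (simp add: short_exact_def image_image comp_def)
qed

definition pull_ext ::
  "'c set \<Rightarrow> ('c \<Rightarrow> 'a) \<Rightarrow> 'd set \<Rightarrow> ('d \<Rightarrow> 'b) \<Rightarrow> ('k, 'a, 'b, 'g, 'h, 'v, 'w) extension_data \<Rightarrow>
   ('k, 'c, 'd, 'g, 'h, 'v, 'w) extension_data" where
  "pull_ext C f D g X = \<lparr>mpG = pull_lie C f (mpG X), mpH = pull_lie D g (mpH X),
     mprho = (\<lambda>x h. inv_into D g (mprho X (f x) (g h))),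
     mppsi = (\<lambda>h x. inv_into C f (mppsi X (g h) (f x))),
     incl1 = (\<lambda>v. inv_into C f (incl1 X v)), incl2 = (\<lambda>w. inv_into D g (incl2 X w)),
     proj1 = (\<lambda>x. proj1 X (f x)), proj2 = (\<lambda>h. proj2 X (g h))\<rparr>"

lemma pull_ext_simps [simp]:
  "mpG (pull_ext C f D g X) = pull_lie C f (mpG X)"
  "mpH (pull_ext C f D g X) = pull_lie D g (mpH X)"
  "mprho (pull_ext C f D g X) x h = inv_into D g (mprho X (f x) (g h))"
  "mppsi (pull_ext C f D g X) h x = inv_into C f (mppsi X (g h) (f x))"
  "incl1 (pull_ext C f D g X) v = inv_into C f (incl1 X v)"
  "incl2 (pull_ext C f D g X) w = inv_into D g (incl2 X w)"
  "proj1 (pull_ext C f D g X) x = proj1 X (f x)"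
  "proj2 (pull_ext C f D g X) h = proj2 X (g h)"
  by (simp_all add: pull_ext_def)

section \<open>Isomorphisms of extensions\<close>

text \<open>Unlike in \<open>isomorphic_ext\<close>, the two extensions may live on different types,
  so a twisted product on product types can be compared with an extension on \<open>'a\<close> and
  \<open>'b\<close>.\<close>

definition ext_iso ::
  "('k::field_char_0, 'a, 'b, 'g, 'h, 'v, 'w) extension_data \<Rightarrow>
   ('k, 'c, 'd, 'g, 'h, 'v, 'w) extension_data \<Rightarrow> ('a \<Rightarrow> 'c) \<Rightarrow> ('b \<Rightarrow> 'd) \<Rightarrow> bool" where
  "ext_iso X Y f g \<longleftrightarrow> mp_iso X Y f g \<and>
     (\<forall>v. f (incl1 X v) = incl1 Y v) \<and> (\<forall>w. g (incl2 X w) = incl2 Y w) \<and>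
     (\<forall>a\<in>carr (mpG X). proj1 Y (f a) = proj1 X a) \<and>
     (\<forall>b\<in>carr (mpH X). proj2 Y (g b) = proj2 X b)"

lemma isomorphic_ext_iff: "isomorphic_ext X Y \<longleftrightarrow> (\<exists>f g. ext_iso X Y f g)"
  by (simp add: isomorphic_ext_def ext_iso_def)

lemma ext_iso_id: "ext_iso X X (\<lambda>x. x) (\<lambda>x. x)"
  by (simp add: ext_iso_def mp_iso_def mp_hom_def lie_hom_def linear_on_def bij_betw_def)

lemma ext_iso_comp:
  assumes "ext_iso X Y f g" "ext_iso Y Z f' g'"
  shows "ext_iso X Z (f' \<circ> f) (g' \<circ> g)"
proof -
  have "f x \<in> carr (mpG Y)" if "x \<in> carr (mpG X)" for x
    using assms(1) that by (simp add: ext_iso_def mp_iso_def mp_hom_def lie_hom_def linear_on_def)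
  moreover have "g x \<in> carr (mpH Y)" if "x \<in> carr (mpH X)" for x
    using assms(1) that by (simp add: ext_iso_def mp_iso_def mp_hom_def lie_hom_def linear_on_def)
  ultimately show ?thesis
    using assms unfolding ext_iso_def mp_iso_def mp_hom_def lie_hom_def linear_on_def
    by (auto intro: bij_betw_trans)
qed

lemma matched_pair_closed:
  assumes "matched_pair X"
  shows "x \<in> carr (mpG X) \<Longrightarrow> y \<in> carr (mpG X) \<Longrightarrow> vadd (mpG X) x y \<in> carr (mpG X)"
    and "x \<in> carr (mpG X) \<Longrightarrow> vscale (mpG X) t x \<in> carr (mpG X)"
    and "x \<in> carr (mpG X) \<Longrightarrow> y \<in> carr (mpG X) \<Longrightarrow> lbrack (mpG X) x y \<in> carr (mpG X)"
    and "h \<in> carr (mpH X) \<Longrightarrow> k \<in> carr (mpH X) \<Longrightarrow> vadd (mpH X) h k \<in> carr (mpH X)"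
    and "h \<in> carr (mpH X) \<Longrightarrow> vscale (mpH X) t h \<in> carr (mpH X)"
    and "h \<in> carr (mpH X) \<Longrightarrow> k \<in> carr (mpH X) \<Longrightarrow> lbrack (mpH X) h k \<in> carr (mpH X)"
    and "x \<in> carr (mpG X) \<Longrightarrow> h \<in> carr (mpH X) \<Longrightarrow> mprho X x h \<in> carr (mpH X)"
    and "x \<in> carr (mpG X) \<Longrightarrow> h \<in> carr (mpH X) \<Longrightarrow> mppsi X h x \<in> carr (mpG X)"
  using assms
  unfolding matched_pair_def Let_def lie_algebra_def lie_rep_def bilinear_on_def linear_on_def
    vector_space_on_def
  by auto

text \<open>Each operation of \<open>B\<close> on values of \<open>f\<close> is the value of
  \<open>f\<close> at the corresponding operation of \<open>A\<close>. The closure hypotheses keep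
  that argument in the carrier, where \<open>inv_into\<close> undoes \<open>f\<close>.\<close>

lemma lie_hom_inv_into:
  assumes "lie_hom A B f" "bij_betw f (carr A) (carr B)"
    and "\<And>x y. x \<in> carr A \<Longrightarrow> y \<in> carr A \<Longrightarrow> vadd A x y \<in> carr A"
    and "\<And>t x. x \<in> carr A \<Longrightarrow> vscale A t x \<in> carr A"
    and "\<And>x y. x \<in> carr A \<Longrightarrow> y \<in> carr A \<Longrightarrow> lbrack A x y \<in> carr A"
  shows "lie_hom B A (inv_into (carr A) f)"
  using assms(1,3-) bij_betw_inv_into_left[OF assms(2)]
  unfolding lie_hom_def linear_on_def bij_betw_imp_surj_on[OF assms(2), symmetric]
  by (auto simp flip: assms) metis+

lemma ext_iso_inv:
  assumes iso: "ext_iso X Y f g" and X: "matched_pair X"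
    and incl: "range (incl1 X) \<subseteq> carr (mpG X)" "range (incl2 X) \<subseteq> carr (mpH X)"
  shows "ext_iso Y X (inv_into (carr (mpG X)) f) (inv_into (carr (mpH X)) g)"
proof -
  note cl = matched_pair_closed[OF X]
  have bf: "bij_betw f (carr (mpG X)) (carr (mpG Y))" and bg: "bij_betw g (carr (mpH X)) (carr (mpH Y))"
    and hom: "mp_hom X Y f g"
    using iso by (auto simp: ext_iso_def mp_iso_def)
  have 1: "lie_hom (mpG Y) (mpG X) (inv_into (carr (mpG X)) f)"
    by (rule lie_hom_inv_into[OF _ bf cl(1-3)]) (use hom in \<open>simp add: mp_hom_def\<close>)
  have 2: "lie_hom (mpH Y) (mpH X) (inv_into (carr (mpH X)) g)"
    by (rule lie_hom_inv_into[OF _ bg cl(4-6)]) (use hom in \<open>simp add: mp_hom_def\<close>)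
  have fi: "inv_into (carr (mpG X)) f (f x) = x" if "x \<in> carr (mpG X)" for x
    using bij_betw_inv_into_left[OF bf that] .
  have gi: "inv_into (carr (mpH X)) g (g x) = x" if "x \<in> carr (mpH X)" for x
    using bij_betw_inv_into_left[OF bg that] .
  have 3: "inv_into (carr (mpH X)) g (mprho Y x h) =
        mprho X (inv_into (carr (mpG X)) f x) (inv_into (carr (mpH X)) g h) \<and>
      inv_into (carr (mpG X)) f (mppsi Y h x) =
        mppsi X (inv_into (carr (mpH X)) g h) (inv_into (carr (mpG X)) f x)"
    if xh: "x \<in> carr (mpG Y)" "h \<in> carr (mpH Y)" for x h
  proof -
    have "x \<in> f ` carr (mpG X)" "h \<in> g ` carr (mpH X)"
      using xh bf bg by (simp_all add: bij_betw_def)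
    then obtain x' h' where xh': "x' \<in> carr (mpG X)" "x = f x'" "h' \<in> carr (mpH X)" "h = g h'"
      by blast
    then have "mprho Y x h = g (mprho X x' h')" "mppsi Y h x = f (mppsi X h' x')"
      using hom by (simp_all add: mp_hom_def)
    then show ?thesis using xh' fi gi cl(7,8) by simp
  qed
  \<comment> \<open>As \<open>f (incl1 X v) = incl1 Y v\<close>, the inverse returns
    \<open>incl1 X v\<close>; this uses \<open>incl\<close>, because \<open>inv_into\<close> cancels
    \<open>f\<close> only on the carrier.\<close>
  have 4: "inv_into (carr (mpG X)) f (incl1 Y v) = incl1 X v" for v
    using iso incl fi unfolding ext_iso_def by (metis rangeI subsetD)
  have 5: "inv_into (carr (mpH X)) g (incl2 Y v) = incl2 X v" for v
    using iso incl gi unfolding ext_iso_def by (metis rangeI subsetD)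
  have 6: "proj1 X (inv_into (carr (mpG X)) f a) = proj1 Y a" if "a \<in> carr (mpG Y)" for a
    using iso that bf fi unfolding ext_iso_def bij_betw_def by force
  have 7: "proj2 X (inv_into (carr (mpH X)) g a) = proj2 Y a" if "a \<in> carr (mpH Y)" for a
    using iso that bg gi unfolding ext_iso_def bij_betw_def by force
  show ?thesis
    unfolding ext_iso_def mp_iso_def mp_hom_def
    using 1 2 3 4 5 6 7 bij_betw_inv_into[OF bf] bij_betw_inv_into[OF bg] by blast
qed

lemma abelian_extension_incl:
  assumes "abelian_extension M R X"
  shows "range (incl1 X) \<subseteq> carr (mpG X)" "range (incl2 X) \<subseteq> carr (mpH X)"
  using assms
  by (auto simp: abelian_extension_def mp_hom_def lie_hom_def linear_on_def abelian_mp_def abelian_lie_def)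

text \<open>Every condition on an extension concerns values in the carriers, where \<open>f\<close>
  and \<open>g\<close> cancel against their inverses. Sections of \<open>X\<close> followed by these
  inverses witness that the induced representation is unchanged.\<close>

lemma pull_ext_extensions:
  assumes X: "X \<in> extensions M R"
    and f: "bij_betw f C (carr (mpG X))" and g: "bij_betw g D (carr (mpH X))"
  shows "pull_ext C f D g X \<in> extensions M R" and "ext_iso (pull_ext C f D g X) X f g"
proof -
  have mp: "matched_pair X" and ext: "abelian_extension M R X" and ind: "induces_rep M R X"
    using X by (auto simp: extensions_def abelian_extension_def)
  note cl = matched_pair_closed[OF mp]
  have [simp]: "f x \<in> carr (mpG X)" if "x \<in> C" for x using that f by (auto simp: bij_betw_def)
  have [simp]: "inv_into C f y \<in> C" "f (inv_into C f y) = y" if "y \<in> carr (mpG X)" for y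
    using that f by (auto simp: bij_betw_def inv_into_into f_inv_into_f)
  have [simp]: "g x \<in> carr (mpH X)" if "x \<in> D" for x using that g by (auto simp: bij_betw_def)
  have [simp]: "inv_into D g y \<in> D" "g (inv_into D g y) = y" if "y \<in> carr (mpH X)" for y
    using that g by (auto simp: bij_betw_def inv_into_into f_inv_into_f)
  have [simp]: "incl1 X v \<in> carr (mpG X)" "incl2 X w \<in> carr (mpH X)" for v w
    using abelian_extension_incl[OF ext] by auto
  have vs: "vector_space_on (mpG X)" "vector_space_on (mpH X)"
    using mp by (simp_all add: matched_pair_def Let_def lie_algebra_def)
  have rho: "mprho (pull_ext C f D g X) = (\<lambda>x h. inv_into D g (mprho X (f x) (g h)))"
    and psi: "mppsi (pull_ext C f D g X) = (\<lambda>h x. inv_into C f (mppsi X (g h) (f x)))"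
    by (simp_all add: pull_ext_def)
  have "lie_algebra (pull_lie C f (mpG X))" "lie_algebra (pull_lie D g (mpH X))"
    "lie_rep (pull_lie C f (mpG X)) (pull_lie D g (mpH X)) (mprho (pull_ext C f D g X))"
    "lie_rep (pull_lie D g (mpH X)) (pull_lie C f (mpG X)) (mppsi (pull_ext C f D g X))"
    using mp f g unfolding rho psi
    by (auto simp: matched_pair_def Let_def intro!: lie_algebra_pull_lie lie_rep_pull_lie)
  then have mp': "matched_pair (pull_ext C f D g X)"
    using mp by (simp add: matched_pair_def Let_def cl vdiff_pull_lie[OF vs(1) f] vdiff_pull_lie[OF vs(2) g])
  have "mp_hom (abelian_mp R) (pull_ext C f D g X)
      (incl1 (pull_ext C f D g X)) (incl2 (pull_ext C f D g X))"
    using ext by (simp add: abelian_extension_def mp_hom_def lie_hom_def linear_on_def)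
  moreover have "mp_hom (pull_ext C f D g X) M
      (proj1 (pull_ext C f D g X)) (proj2 (pull_ext C f D g X))"
    using ext by (simp add: abelian_extension_def mp_hom_def lie_hom_def linear_on_def cl)
  moreover have "short_exact (mpG (abelian_mp R)) (mpG (pull_ext C f D g X)) (mpG M)
      (incl1 (pull_ext C f D g X)) (proj1 (pull_ext C f D g X))"
    using ext short_exact_pull_lie[OF _ f, of _ _ "incl1 X" "proj1 X"]
    by (simp add: abelian_extension_def pull_ext_def)
  moreover have "short_exact (mpH (abelian_mp R)) (mpH (pull_ext C f D g X)) (mpH M)
      (incl2 (pull_ext C f D g X)) (proj2 (pull_ext C f D g X))"
    using ext short_exact_pull_lie[OF _ g, of _ _ "incl2 X" "proj2 X"]
    by (simp add: abelian_extension_def pull_ext_def)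
  ultimately have "abelian_extension M R (pull_ext C f D g X)"
    using mp' by (simp add: abelian_extension_def)
  moreover have "induces_rep M R (pull_ext C f D g X)"
  proof -
    obtain s1 s2 where s: "linear_section (mpG X) (mpG M) (proj1 X) s1"
        "linear_section (mpH X) (mpH M) (proj2 X) s2"
      and eqs: "\<forall>x\<in>carr (mpG M). \<forall>h\<in>carr (mpH M). \<forall>v w.
           incl1 X (rhoV R x v) = lbrack (mpG X) (s1 x) (incl1 X v) \<and>
           incl2 X (rhoW R x w) = mprho X (s1 x) (incl2 X w) \<and>
           incl1 X (psiV R h v) = mppsi X (s2 h) (incl1 X v) \<and>
           incl2 X (psiW R h w) = lbrack (mpH X) (s2 h) (incl2 X w) \<and>
           incl2 X (rep_alpha R v h) = mprho X (incl1 X v) (s2 h) \<and>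
           incl1 X (rep_beta R w x) = mppsi X (incl2 X w) (s1 x)"
      using ind unfolding induces_rep_def by blast
    have [simp]: "s1 x \<in> carr (mpG X)" if "x \<in> carr (mpG M)" for x
      using that s by (simp add: linear_section_def linear_on_def)
    have [simp]: "s2 x \<in> carr (mpH X)" if "x \<in> carr (mpH M)" for x
      using that s by (simp add: linear_section_def linear_on_def)
    have "linear_section (pull_lie C f (mpG X)) (mpG M) (proj1 (pull_ext C f D g X))
        (\<lambda>x. inv_into C f (s1 x))"
      using s by (simp add: linear_section_def linear_on_def)
    moreover have "linear_section (pull_lie D g (mpH X)) (mpH M) (proj2 (pull_ext C f D g X))
        (\<lambda>x. inv_into D g (s2 x))"
      using s by (simp add: linear_section_def linear_on_def)
    ultimately show ?thesis
      unfolding induces_rep_def pull_ext_simps(1,2) using eqs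
      by (intro exI[of _ "\<lambda>x. inv_into C f (s1 x)"] exI[of _ "\<lambda>h. inv_into D g (s2 h)"]) simp
  qed
  ultimately show "pull_ext C f D g X \<in> extensions M R"
    by (simp add: extensions_def)
  show "ext_iso (pull_ext C f D g X) X f g"
    using f g by (simp add: ext_iso_def mp_iso_def mp_hom_def lie_hom_def linear_on_def cl)
qed

lemma ext_iso_sym:
  assumes "ext_iso X Y f g" "X \<in> extensions M R"
  shows "\<exists>f g. ext_iso Y X f g"
proof -
  have "abelian_extension M R X" using assms(2) by (simp add: extensions_def)
  then show ?thesis
    using ext_iso_inv[OF assms(1) _ abelian_extension_incl] unfolding abelian_extension_def by blast
qed

lemma equiv_isomorphic_ext:
  "equiv (extensions M R) {(X, Y). X \<in> extensions M R \<and> Y \<in> extensions M R \<and> isomorphic_ext X Y}"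
    (is "equiv ?A ?r")
proof (rule equivI)
  show "refl_on ?A ?r"
    using ext_iso_id by (fastforce simp: refl_on_def isomorphic_ext_iff)
  show "sym ?r"
    unfolding isomorphic_ext_iff by (rule symI) (use ext_iso_sym in blast)
  show "trans ?r"
    unfolding isomorphic_ext_iff by (rule transI) (use ext_iso_comp in blast)
qed auto

section \<open>Structures carried by whole types\<close>

text \<open>The identities compared below involve no scalars, so additivity in each argument is all
  they need from bilinearity. Separating it from scalar compatibility yields expansion rules that
  hold for all arguments.\<close>

definition biadditive :: "('a::ab_group_add \<Rightarrow> 'b::ab_group_add \<Rightarrow> 'c::ab_group_add) \<Rightarrow> bool" where
  "biadditive f \<longleftrightarrow>
     (\<forall>x x' y. f (x + x') y = f x y + f x' y) \<and> (\<forall>x y y'. f x (y + y') = f x y + f x y')"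

lemma biadditive_simps:
  assumes "biadditive f"
  shows "f (x + x') y = f x y + f x' y" "f x (y + y') = f x y + f x y'"
    and "f 0 y = 0" "f x 0 = 0" "f (- x) y = - f x y" "f x (- y) = - f x y"
    and "f (x - x') y = f x y - f x' y" "f x (y - y') = f x y - f x y'"
proof -
  have 1: "f (x + x') y = f x y + f x' y" and 2: "f x (y + y') = f x y + f x y'" for x x' y y'
    using assms by (simp_all add: biadditive_def)
  interpret l: additive "\<lambda>x. f x y" for y by unfold_locales (rule 1)
  interpret r: additive "f x" for x by unfold_locales (rule 2)
  show "f (x + x') y = f x y + f x' y" "f x (y + y') = f x y + f x y'"
    "f 0 y = 0" "f x 0 = 0" "f (- x) y = - f x y" "f x (- y) = - f x y"
    "f (x - x') y = f x y - f x' y" "f x (y - y') = f x y - f x y'"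
    by (fact 1 2 l.zero r.zero l.minus r.minus l.diff r.diff)+
qed

text \<open>Polarisation: expand \<open>f (x + y) (x + y) = 0\<close>.\<close>

lemma biadditive_alternating:
  assumes "biadditive f" "\<And>x. f x x = 0"
  shows "f y x = - f x y"
proof -
  have "f (x + y) (x + y) = f x x + f x y + (f y x + f y y)"
    by (simp only: biadditive_simps(1,2)[OF assms(1)] add_ac)
  then have "f x y + f y x = 0"
    by (simp add: assms(2))
  then show ?thesis by (simp add: eq_neg_iff_add_eq_0 add.commute)
qed

lemma bilinear_on_on_type:
  assumes "on_type A" "on_type B" "on_type C"
  shows "bilinear_on A B C f \<longleftrightarrow> biadditive f \<and>
    (\<forall>t x y. f (vscale A t x) y = vscale C t (f x y)) \<and>
    (\<forall>t x y. f x (vscale B t y) = vscale C t (f x y))"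
  using assms by (auto simp: bilinear_on_def linear_on_def on_type_def biadditive_def)

lemma linear_on_on_type:
  assumes "on_type A" "on_type B"
  shows "linear_on A B f \<longleftrightarrow>
    (\<forall>x y. f (x + y) = f x + f y) \<and> (\<forall>t x. f (vscale A t x) = vscale B t (f x))"
  using assms by (auto simp: linear_on_def on_type_def)

lemma vector_space_on_on_type:
  assumes "on_type A"
  shows "vector_space_on A \<longleftrightarrow> vector_space (vscale A)"
proof -
  have "\<exists>y. x + y = 0" for x :: 'b by (rule exI[of _ "- x"]) simp
  then show ?thesis
    using assms unfolding vector_space_on_def vector_space_def on_type_def
    by (auto simp: add.assoc add.commute)
qed

lemma vdiff_on_type:
  assumes "on_type A" "vector_space (vscale A)"
  shows "vdiff A x y = x - y"
proof -
  interpret vector_space "vscale A" by fact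
  show ?thesis
    using assms(1) scale_minus_left[of 1 y] by (simp add: vdiff_def on_type_def)
qed

lemma on_type_abelian_lie [simp]: "on_type (abelian_lie s)"
  by (simp add: on_type_def abelian_lie_def)

lemma abelian_lie_simps [simp]:
  "carr (abelian_lie s) = UNIV" "vadd (abelian_lie s) = (+)" "vzero (abelian_lie s) = 0"
  "vscale (abelian_lie s) = s" "lbrack (abelian_lie s) x y = 0"
  by (simp_all add: abelian_lie_def)

lemma abelian_mp_simps [simp]:
  "mpG (abelian_mp R) = abelian_lie (scaleV R)" "mpH (abelian_mp R) = abelian_lie (scaleW R)"
  "mprho (abelian_mp R) v w = 0" "mppsi (abelian_mp R) w v = 0"
  by (simp_all add: abelian_mp_def)

text \<open>The conditions are grouped on purpose. The first, bracketed block is linear or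
  alternating in nature and holds for every product twisted by bilinear maps with \<open>a\<close>
  and \<open>d\<close> alternating. The remaining six identities are those whose failure on such a
  product is measured by \<open>coc1\<close> to \<open>coc6\<close>.\<close>

lemma matched_pair_on_type_iff:
  assumes "on_type (mpG M)" "on_type (mpH M)"
  shows "matched_pair M \<longleftrightarrow>
    (vector_space (vscale (mpG M)) \<and> vector_space (vscale (mpH M)) \<and>
     bilinear_on (mpG M) (mpG M) (mpG M) (lbrack (mpG M)) \<and>
     bilinear_on (mpH M) (mpH M) (mpH M) (lbrack (mpH M)) \<and>
     bilinear_on (mpG M) (mpH M) (mpH M) (mprho M) \<and>
     bilinear_on (mpH M) (mpG M) (mpG M) (mppsi M) \<and>
     (\<forall>x. lbrack (mpG M) x x = 0) \<and> (\<forall>h. lbrack (mpH M) h h = 0)) \<and>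
     (\<forall>x y z. lbrack (mpG M) x (lbrack (mpG M) y z) +
        (lbrack (mpG M) y (lbrack (mpG M) z x) + lbrack (mpG M) z (lbrack (mpG M) x y)) = 0) \<and>
     (\<forall>x y z. lbrack (mpH M) x (lbrack (mpH M) y z) +
        (lbrack (mpH M) y (lbrack (mpH M) z x) + lbrack (mpH M) z (lbrack (mpH M) x y)) = 0) \<and>
     (\<forall>x y h. mprho M (lbrack (mpG M) x y) h =
        mprho M x (mprho M y h) - mprho M y (mprho M x h)) \<and>
     (\<forall>h k x. mppsi M (lbrack (mpH M) h k) x =
        mppsi M h (mppsi M k x) - mppsi M k (mppsi M h x)) \<and>
     (\<forall>x h k. mprho M x (lbrack (mpH M) h k) =
        lbrack (mpH M) (mprho M x h) k + lbrack (mpH M) h (mprho M x k)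
        + mprho M (mppsi M k x) h - mprho M (mppsi M h x) k) \<and>
     (\<forall>h x y. mppsi M h (lbrack (mpG M) x y) =
        lbrack (mpG M) (mppsi M h x) y + lbrack (mpG M) x (mppsi M h y)
        + mppsi M (mprho M y h) x - mppsi M (mprho M x h) y)"
proof -
  have "carr (mpG M) = UNIV" "vadd (mpG M) = (+)" "vzero (mpG M) = 0"
    "carr (mpH M) = UNIV" "vadd (mpH M) = (+)" "vzero (mpH M) = 0"
    using assms by (auto simp: on_type_def)
  then show ?thesis
    unfolding matched_pair_def lie_algebra_def lie_rep_def Let_def
      vector_space_on_on_type[OF assms(1)] vector_space_on_on_type[OF assms(2)]
    by (auto simp: vdiff_on_type assms)
qed

section \<open>Extensions on products\<close>

definition prod_lie ::
  "('k, 'a::ab_group_add) lie_data \<Rightarrow> ('k \<Rightarrow> 'u::ab_group_add \<Rightarrow> 'u) \<Rightarrow>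
   ('a \<times> 'u \<Rightarrow> 'a \<times> 'u \<Rightarrow> 'a \<times> 'u) \<Rightarrow> ('k, 'a \<times> 'u) lie_data" where
  "prod_lie A s br = \<lparr>carr = UNIV, vadd = (+), vzero = 0,
     vscale = (\<lambda>t (x, u). (vscale A t x, s t u)), lbrack = br\<rparr>"

lemma prod_lie_simps [simp]:
  "carr (prod_lie A s br) = UNIV" "vadd (prod_lie A s br) = (+)" "vzero (prod_lie A s br) = 0"
  "vscale (prod_lie A s br) t (x, u) = (vscale A t x, s t u)" "lbrack (prod_lie A s br) = br"
  by (simp_all add: prod_lie_def)

lemma on_type_prod_lie [simp]: "on_type (prod_lie A s br)"
  by (simp add: on_type_def prod_lie_def)

lemma vector_space_prod_lie:
  assumes "vector_space (vscale A)" "vector_space s"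
  shows "vector_space (vscale (prod_lie A s br))"
  using assms by (simp add: vector_space_def prod_lie_def split_beta)

text \<open>The sign and the argument order of \<open>b\<close> come from the bicrossed product
  bracket: on \<open>x\<close> in \<open>\<gg>\<close> and \<open>k\<close> in \<open>\<hh>\<close>
  its \<open>\<gg>\<close>-component is \<open>- \<psi> k x\<close>. Subtracting \<open>b\<close> in
  \<open>mppsi\<close> therefore makes it appear as \<open>+ b x k\<close> in the bracket, as it
  does in the cochain.\<close>

definition std_ext ::
  "('k::field_char_0, 'g::ab_group_add, 'h::ab_group_add) matched_pair_data \<Rightarrow>
   ('k, 'g, 'h, 'v::ab_group_add, 'w::ab_group_add) mp_rep_data \<Rightarrow>
   ('g \<Rightarrow> 'g \<Rightarrow> 'v) \<Rightarrow> ('g \<Rightarrow> 'h \<Rightarrow> 'v) \<Rightarrow> ('g \<Rightarrow> 'h \<Rightarrow> 'w) \<Rightarrow> ('h \<Rightarrow> 'h \<Rightarrow> 'w) \<Rightarrow>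
   ('k, 'g \<times> 'v, 'h \<times> 'w, 'g, 'h, 'v, 'w) extension_data" where
  "std_ext M R a b c d = \<lparr>
     mpG = prod_lie (mpG M) (scaleV R)
       (\<lambda>(x, u) (y, v). (lbrack (mpG M) x y, rhoV R x v - rhoV R y u + a x y)),
     mpH = prod_lie (mpH M) (scaleW R)
       (\<lambda>(h, w) (k, w'). (lbrack (mpH M) h k, psiW R h w' - psiW R k w + d h k)),
     mprho = (\<lambda>(x, u) (k, w'). (mprho M x k, rhoW R x w' + rep_alpha R u k + c x k)),
     mppsi = (\<lambda>(h, w) (y, v). (mppsi M h y, psiV R h v + rep_beta R w y - b y h)),
     incl1 = (\<lambda>v. (0, v)), incl2 = (\<lambda>w. (0, w)), proj1 = fst, proj2 = fst\<rparr>"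

lemma std_ext_simps [simp]:
  "mpG (std_ext M R a b c d) = prod_lie (mpG M) (scaleV R)
     (\<lambda>(x, u) (y, v). (lbrack (mpG M) x y, rhoV R x v - rhoV R y u + a x y))"
  "mpH (std_ext M R a b c d) = prod_lie (mpH M) (scaleW R)
     (\<lambda>(h, w) (k, w'). (lbrack (mpH M) h k, psiW R h w' - psiW R k w + d h k))"
  "mprho (std_ext M R a b c d) (x, u) (k, w') = (mprho M x k, rhoW R x w' + rep_alpha R u k + c x k)"
  "mppsi (std_ext M R a b c d) (h, w) (y, v) = (mppsi M h y, psiV R h v + rep_beta R w y - b y h)"
  "incl1 (std_ext M R a b c d) v = (0, v)" "incl2 (std_ext M R a b c d) w = (0, w)"
  "proj1 (std_ext M R a b c d) X = fst X" "proj2 (std_ext M R a b c d) K = fst K"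
  by (simp_all add: std_ext_def)

locale mp_rep_on_type =
  fixes M :: "('k::field_char_0, 'g::ab_group_add, 'h::ab_group_add) matched_pair_data"
    and R :: "('k, 'g, 'h, 'v::ab_group_add, 'w::ab_group_add) mp_rep_data"
  assumes on_type: "on_type (mpG M)" "on_type (mpH M)"
    and matched_pair: "matched_pair M"
    and mp_rep: "mp_rep M R"
begin

abbreviation "bg \<equiv> lbrack (mpG M)"
abbreviation "bh \<equiv> lbrack (mpH M)"
abbreviation "\<rho> \<equiv> mprho M"
abbreviation "\<psi> \<equiv> mppsi M"
abbreviation "sg \<equiv> vscale (mpG M)"
abbreviation "sh \<equiv> vscale (mpH M)"
abbreviation "sv \<equiv> scaleV R"
abbreviation "sw \<equiv> scaleW R"
abbreviation "\<rho>V \<equiv> rhoV R"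
abbreviation "\<rho>W \<equiv> rhoW R"
abbreviation "\<psi>V \<equiv> psiV R"
abbreviation "\<psi>W \<equiv> psiW R"
abbreviation "\<alpha> \<equiv> rep_alpha R"
abbreviation "\<beta> \<equiv> rep_beta R"

lemma carr [simp]:
  "carr (mpG M) = UNIV" "vadd (mpG M) = (+)" "vzero (mpG M) = 0"
  "carr (mpH M) = UNIV" "vadd (mpH M) = (+)" "vzero (mpH M) = 0"
  using on_type by (auto simp: on_type_def)

lemma vector_spaces: "vector_space sg" "vector_space sh" "vector_space sv" "vector_space sw"
  using matched_pair mp_rep by (simp_all add: matched_pair_on_type_iff on_type mp_rep_def Let_def)

lemma bilinear_structure:
  "bilinear_on (mpG M) (mpG M) (mpG M) bg" "bilinear_on (mpH M) (mpH M) (mpH M) bh"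
  "bilinear_on (mpG M) (mpH M) (mpH M) \<rho>" "bilinear_on (mpH M) (mpG M) (mpG M) \<psi>"
  "bilinear_on (mpG M) (abelian_lie sv) (abelian_lie sv) \<rho>V"
  "bilinear_on (mpG M) (abelian_lie sw) (abelian_lie sw) \<rho>W"
  "bilinear_on (mpH M) (abelian_lie sv) (abelian_lie sv) \<psi>V"
  "bilinear_on (mpH M) (abelian_lie sw) (abelian_lie sw) \<psi>W"
  "bilinear_on (abelian_lie sv) (mpH M) (abelian_lie sw) \<alpha>"
  "bilinear_on (abelian_lie sw) (mpG M) (abelian_lie sv) \<beta>"
  using matched_pair mp_rep
  by (simp_all add: matched_pair_on_type_iff on_type mp_rep_def Let_def lie_rep_def)

lemmas bilinear_structure' = bilinear_structure[unfolded
    bilinear_on_on_type[OF on_type(1) on_type(1) on_type(1)]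
    bilinear_on_on_type[OF on_type(2) on_type(2) on_type(2)]
    bilinear_on_on_type[OF on_type(1) on_type(2) on_type(2)]
    bilinear_on_on_type[OF on_type(2) on_type(1) on_type(1)]
    bilinear_on_on_type[OF on_type(1) on_type_abelian_lie on_type_abelian_lie]
    bilinear_on_on_type[OF on_type(2) on_type_abelian_lie on_type_abelian_lie]
    bilinear_on_on_type[OF on_type_abelian_lie on_type(1) on_type_abelian_lie]
    bilinear_on_on_type[OF on_type_abelian_lie on_type(2) on_type_abelian_lie] abelian_lie_simps]

lemmas additive_structure = bilinear_structure'[THEN conjunct1, THEN biadditive_simps(1)]
  bilinear_structure'[THEN conjunct1, THEN biadditive_simps(2)]
  bilinear_structure'[THEN conjunct1, THEN biadditive_simps(3)]
  bilinear_structure'[THEN conjunct1, THEN biadditive_simps(4)]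
  bilinear_structure'[THEN conjunct1, THEN biadditive_simps(5)]
  bilinear_structure'[THEN conjunct1, THEN biadditive_simps(6)]
  bilinear_structure'[THEN conjunct1, THEN biadditive_simps(7)]
  bilinear_structure'[THEN conjunct1, THEN biadditive_simps(8)]

lemmas scale_structure = bilinear_structure'[THEN conjunct2, THEN conjunct1, rule_format]
  bilinear_structure'[THEN conjunct2, THEN conjunct2, rule_format]

lemma scale_add:
  "sv t (v + v') = sv t v + sv t v'" "sw t (w + w') = sw t w + sw t w'"
  "sv t (v - v') = sv t v - sv t v'" "sw t (w - w') = sw t w - sw t w'"
  "sv t (- v) = - sv t v" "sw t (- w) = - sw t w"
  "sv t 0 = 0" "sw t 0 = 0" "sg t 0 = 0" "sh t 0 = 0"
  "sg t (x + x') = sg t x + sg t x'" "sh t (h + h') = sh t h + sh t h'"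
proof -
  interpret V: vector_space sv by (fact vector_spaces)
  interpret W: vector_space sw by (fact vector_spaces)
  interpret G: vector_space sg by (fact vector_spaces)
  interpret H: vector_space sh by (fact vector_spaces)
  show "sv t (v + v') = sv t v + sv t v'" "sw t (w + w') = sw t w + sw t w'"
    "sv t (v - v') = sv t v - sv t v'" "sw t (w - w') = sw t w - sw t w'"
    "sv t (- v) = - sv t v" "sw t (- w) = - sw t w"
    "sv t 0 = 0" "sw t 0 = 0" "sg t 0 = 0" "sh t 0 = 0"
    "sg t (x + x') = sg t x + sg t x'" "sh t (h + h') = sh t h + sh t h'"
    by (simp_all add: V.scale_right_distrib W.scale_right_distrib G.scale_right_distrib
        H.scale_right_distrib V.scale_right_diff_distrib W.scale_right_diff_distrib)
qed

lemma bracket_self [simp]: "bg x x = 0" "bh h h = 0"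
  using matched_pair by (simp_all add: matched_pair_on_type_iff on_type)

lemma jacobi:
  "bg x (bg y z) + (bg y (bg z x) + bg z (bg x y)) = 0"
  "bh h (bh k l) + (bh k (bh l h) + bh l (bh h k)) = 0"
  using matched_pair by (simp_all add: matched_pair_on_type_iff on_type)

lemma mp_rules:
  "\<rho> (bg x y) h = \<rho> x (\<rho> y h) - \<rho> y (\<rho> x h)"
  "\<psi> (bh h k) x = \<psi> h (\<psi> k x) - \<psi> k (\<psi> h x)"
  "\<rho> x (bh h k) = bh (\<rho> x h) k + bh h (\<rho> x k) + \<rho> (\<psi> k x) h - \<rho> (\<psi> h x) k"
  "\<psi> h (bg x y) = bg (\<psi> h x) y + bg x (\<psi> h y) + \<psi> (\<rho> y h) x - \<psi> (\<rho> x h) y"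
  using matched_pair by (simp_all add: matched_pair_on_type_iff on_type)

lemma rep_rules:
  "\<rho>V (bg x y) v = \<rho>V x (\<rho>V y v) - \<rho>V y (\<rho>V x v)"
  "\<rho>W (bg x y) w = \<rho>W x (\<rho>W y w) - \<rho>W y (\<rho>W x w)"
  "\<psi>V (bh h k) v = \<psi>V h (\<psi>V k v) - \<psi>V k (\<psi>V h v)"
  "\<psi>W (bh h k) w = \<psi>W h (\<psi>W k w) - \<psi>W k (\<psi>W h w)"
  "\<alpha> (\<rho>V x v) h = \<rho>W x (\<alpha> v h) - \<alpha> v (\<rho> x h)"
  "\<beta> (\<psi>W h w) x = \<psi>V h (\<beta> w x) - \<beta> w (\<psi> h x)"
  "\<rho>W x (\<psi>W h w) = \<psi>W (\<rho> x h) w + \<psi>W h (\<rho>W x w) + \<alpha> (\<beta> w x) h - \<rho>W (\<psi> h x) w"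
  "\<alpha> v (bh h k) = - \<psi>W k (\<alpha> v h) + \<psi>W h (\<alpha> v k) + \<alpha> (\<psi>V k v) h - \<alpha> (\<psi>V h v) k"
  "\<psi>V h (\<rho>V x v) = \<rho>V (\<psi> h x) v + \<rho>V x (\<psi>V h v) + \<beta> (\<alpha> v h) x - \<psi>V (\<rho> x h) v"
  "\<beta> w (bg x y) = - \<rho>V y (\<beta> w x) + \<rho>V x (\<beta> w y) + \<beta> (\<rho>W y w) x - \<beta> (\<rho>W x w) y"
  using mp_rep
  by (simp_all add: mp_rep_def Let_def lie_rep_def vdiff_on_type vector_spaces)

section \<open>Two-cochains in coordinates and their obstructions\<close>

definition cochain_maps where
  "cochain_maps a b c d \<longleftrightarrow>
     bilinear_on (mpG M) (mpG M) (abelian_lie sv) a \<and> bilinear_on (mpG M) (mpH M) (abelian_lie sv) b \<and>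
     bilinear_on (mpG M) (mpH M) (abelian_lie sw) c \<and> bilinear_on (mpH M) (mpH M) (abelian_lie sw) d \<and>
     (\<forall>x. a x x = 0) \<and> (\<forall>h. d h h = 0)"

lemma cochain_mapsD:
  assumes "cochain_maps a b c d"
  shows "biadditive a" "biadditive b" "biadditive c" "biadditive d"
    and "a x x = 0" "d h h = 0" "a y x = - a x y" "d k h = - d h k"
    and "a (sg t x) y = sv t (a x y)" "a x (sg t y) = sv t (a x y)"
    and "b (sg t x) h = sv t (b x h)" "b x (sh t h) = sv t (b x h)"
    and "c (sg t x) h = sw t (c x h)" "c x (sh t h) = sw t (c x h)"
    and "d (sh t h) k = sw t (d h k)" "d h (sh t k) = sw t (d h k)"
proof -
  show *: "biadditive a" "biadditive b" "biadditive c" "biadditive d"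
    "a x x = 0" "d h h = 0"
    "a (sg t x) y = sv t (a x y)" "a x (sg t y) = sv t (a x y)"
    "b (sg t x) h = sv t (b x h)" "b x (sh t h) = sv t (b x h)"
    "c (sg t x) h = sw t (c x h)" "c x (sh t h) = sw t (c x h)"
    "d (sh t h) k = sw t (d h k)" "d h (sh t k) = sw t (d h k)" for x y h k t
    using assms by (simp_all add: cochain_maps_def bilinear_on_on_type on_type)
  show "a y x = - a x y" "d k h = - d h k"
    using biadditive_alternating[of a] biadditive_alternating[of d] * by blast+
qed

text \<open>Up to sign, the components of the coboundary of a \<open>2\<close>-cochain on homogeneous arguments. Each
  one is the obstruction to one of the six identities of a matched pair on the product.\<close>

definition "coc1 a x y z = \<rho>V x (a y z) + a x (bg y z) + \<rho>V y (a z x) + a y (bg z x)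
  + \<rho>V z (a x y) + a z (bg x y)"
definition "coc2 d h k l = \<psi>W h (d k l) + d h (bh k l) + \<psi>W k (d l h) + d k (bh l h)
  + \<psi>W l (d h k) + d l (bh h k)"
definition "coc3 a c x y h = \<alpha> (a x y) h + c (bg x y) h
  - \<rho>W x (c y h) - c x (\<rho> y h) + \<rho>W y (c x h) + c y (\<rho> x h)"
definition "coc4 b d h k x = \<beta> (d h k) x - b x (bh h k)
  + \<psi>V h (b x k) + b (\<psi> k x) h - \<psi>V k (b x h) - b (\<psi> h x) k"
definition "coc5 b c d x h k = \<rho>W x (d h k) + c x (bh h k) + \<psi>W k (c x h) - d (\<rho> x h) k
  - \<psi>W h (c x k) - d h (\<rho> x k) + \<alpha> (b x k) h - c (\<psi> k x) h - \<alpha> (b x h) k + c (\<psi> h x) k"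
definition "coc6 a b c h x y = \<psi>V h (a x y) - b (bg x y) h - \<rho>V y (b x h) - a (\<psi> h x) y
  + \<rho>V x (b y h) - a x (\<psi> h y) - \<beta> (c y h) x + b x (\<rho> y h) + \<beta> (c x h) y - b y (\<rho> x h)"

definition "cocycle_maps a b c d \<longleftrightarrow> (\<forall>x y z. coc1 a x y z = 0) \<and> (\<forall>h k l. coc2 d h k l = 0) \<and>
  (\<forall>x y h. coc3 a c x y h = 0) \<and> (\<forall>h k x. coc4 b d h k x = 0) \<and>
  (\<forall>x h k. coc5 b c d x h k = 0) \<and> (\<forall>h x y. coc6 a b c h x y = 0)"

text \<open>In each of the six identities the first component is the same identity in
  \<open>M\<close>. In the second component all terms that contain a coordinate from
  \<open>V\<close> or \<open>W\<close> cancel by the representation axioms. No twisting map is ever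
  applied to the value of another one, so what is left is linear in \<open>a\<close>,
  \<open>b\<close>, \<open>c\<close>, \<open>d\<close>.\<close>

lemma matched_pair_std_ext_iff:
  assumes abcd: "cochain_maps a b c d"
  shows "matched_pair (std_ext M R a b c d) \<longleftrightarrow> cocycle_maps a b c d"
proof -
  let ?X = "std_ext M R a b c d"
  note D = cochain_mapsD[OF abcd]
  note lin = additive_structure biadditive_simps[OF D(1)] biadditive_simps[OF D(2)]
    biadditive_simps[OF D(3)] biadditive_simps[OF D(4)]
  note ot = on_type_prod_lie
  have bil: "bilinear_on (mpG ?X) (mpG ?X) (mpG ?X) (lbrack (mpG ?X))"
    "bilinear_on (mpH ?X) (mpH ?X) (mpH ?X) (lbrack (mpH ?X))"
    "bilinear_on (mpG ?X) (mpH ?X) (mpH ?X) (mprho ?X)"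
    "bilinear_on (mpH ?X) (mpG ?X) (mpG ?X) (mppsi ?X)"
    by (auto simp: bilinear_on_on_type[OF ot ot ot] biadditive_def lin D(9-16) scale_structure
        scale_add algebra_simps)
  have self: "lbrack (mpG ?X) p p = 0" "lbrack (mpH ?X) q q = 0" for p q
    by (cases p; simp add: D(5,6) zero_prod_def) (cases q; simp add: D(5,6) zero_prod_def)
  have 1: "lbrack (mpG ?X) (x, u) (lbrack (mpG ?X) (y, v) (z, r)) +
      (lbrack (mpG ?X) (y, v) (lbrack (mpG ?X) (z, r) (x, u)) +
       lbrack (mpG ?X) (z, r) (lbrack (mpG ?X) (x, u) (y, v))) = (0, coc1 a x y z)" for x u y v z r
    using jacobi(1)[of x y z] by (simp add: lin rep_rules coc1_def algebra_simps)
  have 2: "lbrack (mpH ?X) (x, u) (lbrack (mpH ?X) (y, v) (z, r)) +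
      (lbrack (mpH ?X) (y, v) (lbrack (mpH ?X) (z, r) (x, u)) +
       lbrack (mpH ?X) (z, r) (lbrack (mpH ?X) (x, u) (y, v))) = (0, coc2 d x y z)" for x u y v z r
    using jacobi(2)[of x y z] by (simp add: lin rep_rules coc2_def algebra_simps)
  have 3: "mprho ?X (lbrack (mpG ?X) (x, u) (y, v)) (h, w) - (mprho ?X (x, u) (mprho ?X (y, v) (h, w))
      - mprho ?X (y, v) (mprho ?X (x, u) (h, w))) = (0, coc3 a c x y h)" for x u y v h w
    by (simp add: lin mp_rules rep_rules coc3_def algebra_simps)
  have 4: "mppsi ?X (lbrack (mpH ?X) (h, w) (k, w')) (x, u) - (mppsi ?X (h, w) (mppsi ?X (k, w') (x, u))
      - mppsi ?X (k, w') (mppsi ?X (h, w) (x, u))) = (0, coc4 b d h k x)" for x u k w' h w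
    by (simp add: lin mp_rules rep_rules coc4_def algebra_simps)
  have 5: "mprho ?X (x, u) (lbrack (mpH ?X) (h, w) (k, w')) -
      (lbrack (mpH ?X) (mprho ?X (x, u) (h, w)) (k, w') + lbrack (mpH ?X) (h, w) (mprho ?X (x, u) (k, w'))
        + mprho ?X (mppsi ?X (k, w') (x, u)) (h, w) - mprho ?X (mppsi ?X (h, w) (x, u)) (k, w'))
      = (0, coc5 b c d x h k)" for x u h w k w'
    by (simp add: lin mp_rules rep_rules coc5_def algebra_simps)
  have 6: "mppsi ?X (h, w) (lbrack (mpG ?X) (x, u) (y, v)) -
      (lbrack (mpG ?X) (mppsi ?X (h, w) (x, u)) (y, v) + lbrack (mpG ?X) (x, u) (mppsi ?X (h, w) (y, v))
        + mppsi ?X (mprho ?X (y, v) (h, w)) (x, u) - mppsi ?X (mprho ?X (x, u) (h, w)) (y, v))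
      = (0, coc6 a b c h x y)" for x u h w y v
    by (simp add: lin mp_rules rep_rules coc6_def algebra_simps)
  have sub: "p = q \<longleftrightarrow> e = 0" if "p - q = (0, e)" for p q :: "'y::ab_group_add \<times> 'z::ab_group_add" and e
    using that by (metis Pair_inject diff_eq_diff_eq right_minus_eq zero_prod_def)
  have vs: "vector_space (vscale (mpG ?X))" "vector_space (vscale (mpH ?X))"
    by (simp_all add: vector_space_prod_lie vector_spaces)
  \<comment> \<open>The obstructions do not mention the coordinates in \<open>V\<close> and
    \<open>W\<close>, so the quantifiers over pairs reduce to quantifiers over \<open>\<gg>\<close>
    and \<open>\<hh>\<close>.\<close>
  show ?thesis
    unfolding matched_pair_on_type_iff[of ?X, unfolded std_ext_simps(1,2), OF ot ot,
        folded std_ext_simps(1,2)[of M R a b c d]] cocycle_maps_def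
    by (simp only: vs bil self split_paired_All 1 2 sub[OF 3] sub[OF 4] sub[OF 5] sub[OF 6])
      (simp add: zero_prod_def)
qed

end

section \<open>Splitting an exact sequence along a linear section\<close>

lemma vector_space_on_zero:
  assumes "vector_space_on A" "x \<in> carr A"
  shows "vadd A x (vzero A) = x" and "vscale A 0 x = vzero A"
proof -
  note V = vector_space_onD[OF assms(1)]
  have zero: "vadd A x (vzero A) = x" if "x \<in> carr A" for x
    using V(1,5,6) that by metis
  then show "vadd A x (vzero A) = x" using assms(2) .
  have c: "vscale A 0 x \<in> carr A"
    using V(3) assms(2) .
  then obtain y where y: "y \<in> carr A" "vadd A (vscale A 0 x) y = vzero A"
    using V(7) by metis
  have "vadd A (vscale A 0 x) (vscale A 0 x) = vscale A 0 x"
    using V(8)[OF assms(2), of 0 0] by simp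
  then have "vadd A (vscale A 0 x) (vzero A) = vzero A"
    using V(4)[OF c c y(1)] y by simp
  then show "vscale A 0 x = vzero A" using zero[OF c] by simp
qed

lemma linear_on_zero:
  assumes "vector_space_on A" "vector_space_on B" "linear_on A B f"
  shows "f (vzero A) = vzero B"
proof -
  have z: "vzero A \<in> carr A" using assms(1) by (simp add: vector_space_on_def)
  then have "f (vscale A 0 (vzero A)) = vscale B 0 (f (vzero A))" "f (vzero A) \<in> carr B"
    using assms(3) by (simp_all add: linear_on_def)
  then show ?thesis
    using vector_space_on_zero(2) assms(1,2) z by metis
qed

lemma vector_space_on_left_cancel:
  assumes "vector_space_on A" "x \<in> carr A" "y \<in> carr A" "z \<in> carr A" "vadd A x y = vadd A x z"
  shows "y = z"
proof -
  note V = vector_space_onD[OF assms(1)]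
  obtain n where n: "n \<in> carr A" "vadd A x n = vzero A"
    using V(7)[OF assms(2)] by blast
  have "vadd A n (vadd A x u) = u" if "u \<in> carr A" for u
    using V(4)[OF n(1) assms(2) that] V(5)[OF n(1) assms(2)] V(6)[OF that] n by simp
  then show ?thesis using assms by metis
qed

text \<open>Applying \<open>j\<close> to \<open>s x + i u\<close> recovers \<open>x\<close>, and
  cancelling \<open>s x\<close> recovers \<open>u\<close> because \<open>i\<close> is injective.
  Surjectivity is exactness in the middle, applied to an element corrected by the section.\<close>

lemma section_splitting:
  fixes G :: "('k::field_char_0, 'g::ab_group_add) lie_data" and V :: "('k, 'v::ab_group_add) lie_data"
    and A :: "('k, 'a) lie_data"
  assumes on_type: "on_type G" "on_type V" and vs: "vector_space_on G" "vector_space_on V" "vector_space_on A"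
    and ex: "short_exact V A G i j" and i: "linear_on V A i" and j: "linear_on A G j"
    and s: "linear_section A G j s"
  defines "f \<equiv> \<lambda>(x, u). vadd A (s x) (i u)"
  shows "bij_betw f UNIV (carr A)"
    and "f (p + q) = vadd A (f p) (f q)" and "f (vscale G t x, vscale V t u) = vscale A t (f (x, u))"
    and "f 0 = vzero A" and "f (x, 0) = s x" and "f (0, u) = i u" and "j (f p) = fst p"
proof -
  have [simp]: "carr G = UNIV" "vadd G = (+)" "vzero G = 0" "carr V = UNIV" "vadd V = (+)" "vzero V = 0"
    using on_type by (auto simp: on_type_def)
  have sl: "linear_on G A s" and js [simp]: "j (s x) = x" for x
    using s by (auto simp: linear_section_def)
  have sadd: "s (x + y) = vadd A (s x) (s y)" for x y
    using sl by (simp add: linear_on_def)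
  have [simp]: "s x \<in> carr A" "i u \<in> carr A" for x u
    using sl i by (simp_all add: linear_on_def)
  have add: "vadd A x y \<in> carr A" if "x \<in> carr A" "y \<in> carr A" for x y
    using vs(3) that by (simp add: vector_space_on_def)
  have z: "i 0 = vzero A" "s 0 = vzero A" "j (vzero A) = 0"
    using linear_on_zero[OF vs(2,3) i] linear_on_zero[OF vs(1,3) sl] linear_on_zero[OF vs(3,1) j] by simp_all
  have ji: "j (i u) = 0" for u
    using ex by (auto simp: short_exact_def)
  show jf: "j (f p) = fst p" for p
    using j by (simp add: f_def split_beta linear_on_def ji)
  show fx: "f (x, 0) = s x" and fu: "f (0, u) = i u" for x u
    using vs(3) by (simp_all add: f_def z vector_space_on_zero vector_space_on_def)
  show "f 0 = vzero A" by (simp add: zero_prod_def fx z)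
  show "f (p + q) = vadd A (f p) (f q)"
  proof -
    have ac: "vadd A (vadd A x y) (vadd A u v) = vadd A (vadd A x u) (vadd A y v)"
      if "x \<in> carr A" "y \<in> carr A" "u \<in> carr A" "v \<in> carr A" for x y u v
      using vector_space_onD(2,4)[OF vs(3)] vector_space_on_left_comm[OF vs(3)] that by simp
    show ?thesis
      using sl i by (simp add: f_def split_beta linear_on_def ac)
  qed
  show "f (vscale G t x, vscale V t u) = vscale A t (f (x, u))"
    using sl i vs(3) by (simp add: f_def linear_on_def vector_space_on_def)
  have "inj f"
  proof (rule injI)
    fix p q assume eq: "f p = f q"
    then have fst: "fst p = fst q" by (metis jf)
    have sum: "vadd A (s (fst p)) (i (snd p)) = vadd A (s (fst p)) (i (snd q))"
      using eq fst by (simp add: f_def split_beta)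
    have "i (snd p) = i (snd q)"
      by (rule vector_space_on_left_cancel[OF vs(3) _ _ _ sum]) simp_all
    then have "snd p = snd q"
      using ex by (auto simp: short_exact_def inj_def)
    with fst show "p = q" by (simp add: prod_eq_iff)
  qed
  moreover have "range f = carr A"
  proof (intro equalityI subsetI)
    fix a assume a: "a \<in> carr A"
    \<comment> \<open>This is \<open>a - s (j a)\<close>, an element of the kernel of
      \<open>j\<close>. The negation is taken in the type of \<open>\<gg>\<close>, before applying
      \<open>s\<close>, since the carrier of \<open>A\<close> comes with no negation of its
      own.\<close>
    define a' where "a' = vadd A a (s (- j a))"
    have a': "a' \<in> carr A" using a by (simp add: a'_def add)
    have "j a' = j a + j (s (- j a))"
      using j a by (simp add: linear_on_def a'_def)
    then have "a' \<in> range i"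
      using ex a' by (auto simp: short_exact_def)
    then obtain u where u: "a' = i u" by blast
    have "vadd A (s (- j a)) (s (j a)) = vzero A"
      using sadd[of "- j a" "j a"] z(2) by simp
    then have "a = vadd A a (vadd A (s (- j a)) (s (j a)))"
      using a vs(3) by (simp add: vector_space_on_zero)
    also have "\<dots> = vadd A a' (s (j a))"
      unfolding a'_def by (rule vector_space_onD(4)[OF vs(3), symmetric]) (simp_all add: a)
    also have "\<dots> = vadd A (s (j a)) a'"
      by (rule vector_space_onD(5)[OF vs(3)]) (simp_all add: a')
    finally have "a = f (j a, u)" using u by (simp add: f_def)
    then show "a \<in> range f" by blast
  qed (auto simp: f_def add)
  ultimately show "bij_betw f UNIV (carr A)" by (simp add: bij_betw_def)
qed

context mp_rep_on_type begin

lemma std_ext_in_extensions: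
  assumes abcd: "cochain_maps a b c d" and cocycle: "cocycle_maps a b c d"
  shows "std_ext M R a b c d \<in> extensions M R"
proof -
  let ?X = "std_ext M R a b c d"
  note D = cochain_mapsD[OF abcd]
  note lin = additive_structure biadditive_simps[OF D(1)] biadditive_simps[OF D(2)]
    biadditive_simps[OF D(3)] biadditive_simps[OF D(4)]
  have mp: "matched_pair ?X"
    using matched_pair_std_ext_iff[OF abcd] cocycle by blast
  have "mp_hom (abelian_mp R) ?X (incl1 ?X) (incl2 ?X)"
    by (simp add: mp_hom_def lie_hom_def linear_on_def lin scale_add zero_prod_def)
  moreover have "mp_hom ?X M (proj1 ?X) (proj2 ?X)"
    by (auto simp: mp_hom_def lie_hom_def linear_on_def)
  moreover have "short_exact (mpG (abelian_mp R)) (mpG ?X) (mpG M) (incl1 ?X) (proj1 ?X)"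
    "short_exact (mpH (abelian_mp R)) (mpH ?X) (mpH M) (incl2 ?X) (proj2 ?X)"
    by (auto simp: short_exact_def inj_def image_iff intro: exI[of _ "(_, 0)"])
  ultimately have "abelian_extension M R ?X"
    using mp by (simp add: abelian_extension_def)
  \<comment> \<open>With the zero sections the twist drops out of the induced representation: in
    each of the six products one argument of the twisting map is zero.\<close>
  moreover have "induces_rep M R ?X"
    unfolding induces_rep_def
    by (rule exI[of _ "\<lambda>x. (x, 0)"], rule exI[of _ "\<lambda>h. (h, 0)"])
      (simp add: linear_section_def linear_on_def lin scale_add)
  ultimately show ?thesis by (simp add: extensions_def)
qed

text \<open>Biadditive maps on a product are determined by arguments of the forms
  \<open>(x, 0)\<close> and \<open>(0, u)\<close>. The projections fix all first components, the
  inclusions make every product of two fibre elements vanish, and \<open>ind\<close> gives the mixed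
  products. The only freedom left is the second component on two arguments from the zero sections,
  which is what \<open>a\<close>, \<open>b\<close>, \<open>c\<close>, \<open>d\<close>
  record.\<close>

lemma eq_std_ext:
  fixes Y :: "('k, 'g \<times> 'v, 'h \<times> 'w, 'g, 'h, 'v, 'w) extension_data"
  assumes mp: "matched_pair Y" and proj: "mp_hom Y M (proj1 Y) (proj2 Y)"
    and incl: "mp_hom (abelian_mp R) Y (incl1 Y) (incl2 Y)"
    and Y: "mpG Y = prod_lie (mpG M) sv br1" "mpH Y = prod_lie (mpH M) sw br2"
      "incl1 Y = (\<lambda>v. (0, v))" "incl2 Y = (\<lambda>w. (0, w))" "proj1 Y = fst" "proj2 Y = fst"
    and ind: "\<And>x v. lbrack (mpG Y) (x, 0) (0, v) = (0, \<rho>V x v)"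
      "\<And>h w. lbrack (mpH Y) (h, 0) (0, w) = (0, \<psi>W h w)"
      "\<And>x w. mprho Y (x, 0) (0, w) = (0, \<rho>W x w)" "\<And>v h. mprho Y (0, v) (h, 0) = (0, \<alpha> v h)"
      "\<And>h v. mppsi Y (h, 0) (0, v) = (0, \<psi>V h v)" "\<And>w x. mppsi Y (0, w) (x, 0) = (0, \<beta> w x)"
  shows "\<exists>a b c d. cochain_maps a b c d \<and> Y = std_ext M R a b c d"
proof -
  have ot: "on_type (mpG Y)" "on_type (mpH Y)" by (simp_all add: Y)
  have br: "lbrack (mpG Y) = br1" "lbrack (mpH Y) = br2" by (simp_all add: Y)
  note mp' = mp[unfolded matched_pair_on_type_iff[OF ot] br, THEN conjunct1]
  have bil: "bilinear_on (mpG Y) (mpG Y) (mpG Y) br1" "bilinear_on (mpH Y) (mpH Y) (mpH Y) br2"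
    "bilinear_on (mpG Y) (mpH Y) (mpH Y) (mprho Y)" "bilinear_on (mpH Y) (mpG Y) (mpG Y) (mppsi Y)"
    and self: "br1 p p = 0" "br2 q q = 0" for p q
    using mp' by blast+
  note bil' = bil(1)[unfolded bilinear_on_on_type[OF ot(1) ot(1) ot(1)]]
    bil(2)[unfolded bilinear_on_on_type[OF ot(2) ot(2) ot(2)]]
    bil(3)[unfolded bilinear_on_on_type[OF ot(1) ot(2) ot(2)]]
    bil(4)[unfolded bilinear_on_on_type[OF ot(2) ot(1) ot(1)]]
  have add: "biadditive br1" "biadditive br2" "biadditive (mprho Y)" "biadditive (mppsi Y)"
    using bil' by blast+
  have fst: "fst (br1 p q) = bg (fst p) (fst q)" "fst (br2 r s) = bh (fst r) (fst s)"
    "fst (mprho Y p r) = \<rho> (fst p) (fst r)" "fst (mppsi Y r p) = \<psi> (fst r) (fst p)" for p q r s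
    using proj by (cases p; cases q; cases r; cases s; simp add: mp_hom_def lie_hom_def Y)+
  have zero: "br1 (0, u) (0, v) = 0" "br2 (0, w) (0, w') = 0"
    "mprho Y (0, u) (0, w) = 0" "mppsi Y (0, w) (0, u) = 0" for u v w w'
    using incl by (simp_all add: mp_hom_def lie_hom_def Y zero_prod_def)
  define a where "a x y = snd (br1 (x, 0) (y, 0))" for x y
  \<comment> \<open>The minus sign matches the subtraction of \<open>b\<close> in
    \<open>std_ext\<close>.\<close>
  define b where "b x h = - snd (mppsi Y (h, 0) (x, 0))" for x h
  define c where "c x h = snd (mprho Y (x, 0) (h, 0))" for x h
  define d where "d h k = snd (br2 (h, 0) (k, 0))" for h k
  have basic: "br1 (x, 0) (y, 0) = (bg x y, a x y)" "br2 (h, 0) (k, 0) = (bh h k, d h k)"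
    "mprho Y (x, 0) (h, 0) = (\<rho> x h, c x h)" "mppsi Y (h, 0) (x, 0) = (\<psi> h x, - b x h)" for x y h k
    by (simp_all add: prod_eq_iff fst a_def b_def c_def d_def)
  have split: "(x, u) = (x, 0) + (0, u)" for x :: "'p::ab_group_add" and u :: "'q::ab_group_add"
    by simp
  \<comment> \<open>The hypotheses give the mixed brackets in one order only; the other order
    follows from alternation.\<close>
  have ind': "br1 (x, 0) (0, v) = (0, \<rho>V x v)" "br1 (0, v) (x, 0) = (0, - \<rho>V x v)"
    "br2 (h, 0) (0, w) = (0, \<psi>W h w)" "br2 (0, w) (h, 0) = (0, - \<psi>W h w)" for x v h w
    using ind(1,2) biadditive_alternating[OF add(1) self(1), of "(0, v)" "(x, 0)"]
      biadditive_alternating[OF add(2) self(2), of "(0, w)" "(h, 0)"] by (simp_all add: Y)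
  have "br1 (x, u) (y, v) = (bg x y, \<rho>V x v - \<rho>V y u + a x y)" for x u y v
    by (subst split[of x u], subst split[of y v])
      (simp only: biadditive_simps(1,2)[OF add(1)] basic ind' zero, simp)
  moreover have "br2 (h, w) (k, w') = (bh h k, \<psi>W h w' - \<psi>W k w + d h k)" for h w k w'
    by (subst split[of h w], subst split[of k w'])
      (simp only: biadditive_simps(1,2)[OF add(2)] basic ind' zero, simp)
  moreover have "mprho Y (x, u) (k, w') = (\<rho> x k, \<rho>W x w' + \<alpha> u k + c x k)" for x u k w'
    by (subst split[of x u], subst split[of k w'])
      (simp only: biadditive_simps(1,2)[OF add(3)] basic ind zero, simp)
  moreover have "mppsi Y (h, w) (y, v) = (\<psi> h y, \<psi>V h v + \<beta> w y - b y h)" for h w y v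
    by (subst split[of h w], subst split[of y v])
      (simp only: biadditive_simps(1,2)[OF add(4)] basic ind zero, simp)
  ultimately have "Y = std_ext M R a b c d"
    unfolding std_ext_def
    by (intro extension_data.equality) (simp_all add: Y fun_eq_iff split_paired_All)
  moreover have "cochain_maps a b c d"
  proof -
    have sc: "vscale (mpG Y) t (x, 0) = (sg t x, 0)" "vscale (mpH Y) t (h, 0) = (sh t h, 0)"
      "snd (vscale (mpG Y) t p) = sv t (snd p)" "snd (vscale (mpH Y) t q) = sw t (snd q)" for t x h p q
      by (cases p; cases q; simp add: Y scale_add)+
    have scale: "br1 (sg t x, 0) (y, 0) = vscale (mpG Y) t (br1 (x, 0) (y, 0))"
      "br1 (x, 0) (sg t y, 0) = vscale (mpG Y) t (br1 (x, 0) (y, 0))"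
      "br2 (sh t h, 0) (k, 0) = vscale (mpH Y) t (br2 (h, 0) (k, 0))"
      "br2 (h, 0) (sh t k, 0) = vscale (mpH Y) t (br2 (h, 0) (k, 0))"
      "mprho Y (sg t x, 0) (h, 0) = vscale (mpH Y) t (mprho Y (x, 0) (h, 0))"
      "mprho Y (x, 0) (sh t h, 0) = vscale (mpH Y) t (mprho Y (x, 0) (h, 0))"
      "mppsi Y (sh t h, 0) (x, 0) = vscale (mpG Y) t (mppsi Y (h, 0) (x, 0))"
      "mppsi Y (h, 0) (sg t x, 0) = vscale (mpG Y) t (mppsi Y (h, 0) (x, 0))" for t x y h k
      unfolding sc(1,2)[symmetric]
      by (simp_all only: bil'[THEN conjunct2, THEN conjunct1, rule_format]
          bil'[THEN conjunct2, THEN conjunct2, rule_format])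
    have sum0: "(x + x', 0) = (x, 0) + (x', 0::'q::ab_group_add)" for x x' :: "'p::ab_group_add"
      by simp
    show ?thesis
      unfolding cochain_maps_def bilinear_on_on_type[OF on_type(1) on_type(1) on_type_abelian_lie]
        bilinear_on_on_type[OF on_type(1) on_type(2) on_type_abelian_lie]
        bilinear_on_on_type[OF on_type(2) on_type(2) on_type_abelian_lie] biadditive_def
        a_def b_def c_def d_def
      by (simp add: scale sc self scale_add)
        (simp only: sum0 biadditive_simps(1,2)[OF add(1)] biadditive_simps(1,2)[OF add(2)]
          biadditive_simps(1,2)[OF add(3)] biadditive_simps(1,2)[OF add(4)], simp)
  qed
  ultimately show ?thesis by blast
qed

text \<open>The sections are the witnesses in \<open>induces_rep\<close>, so its equations become
  the mixed products required by \<open>eq_std_ext\<close> once \<open>X\<close> is transported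
  along the splittings \<open>f\<close> and \<open>g\<close>. The transported extension is a matched
  pair, which makes the maps read off from it a cocycle.\<close>

lemma extension_iso_std_ext:
  fixes X :: "('k, 'a, 'b, 'g, 'h, 'v, 'w) extension_data"
  assumes X: "X \<in> extensions M R"
  shows "\<exists>a b c d f g. cochain_maps a b c d \<and> cocycle_maps a b c d \<and>
    ext_iso (std_ext M R a b c d) X f g"
proof -
  have mp: "matched_pair X" and inc: "mp_hom (abelian_mp R) X (incl1 X) (incl2 X)"
    and pro: "mp_hom X M (proj1 X) (proj2 X)"
    and ex: "short_exact (abelian_lie sv) (mpG X) (mpG M) (incl1 X) (proj1 X)"
      "short_exact (abelian_lie sw) (mpH X) (mpH M) (incl2 X) (proj2 X)"
    and ind: "induces_rep M R X"
    using X by (simp_all add: extensions_def abelian_extension_def)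
  have vsX: "vector_space_on (mpG X)" "vector_space_on (mpH X)"
    using mp by (simp_all add: matched_pair_def Let_def lie_algebra_def)
  have vsM: "vector_space_on (mpG M)" "vector_space_on (mpH M)"
    "vector_space_on (abelian_lie sv)" "vector_space_on (abelian_lie sw)"
    by (simp_all add: vector_space_on_on_type on_type vector_spaces)
  have lin: "linear_on (abelian_lie sv) (mpG X) (incl1 X)" "linear_on (abelian_lie sw) (mpH X) (incl2 X)"
    "linear_on (mpG X) (mpG M) (proj1 X)" "linear_on (mpH X) (mpH M) (proj2 X)"
    using inc pro by (simp_all add: mp_hom_def lie_hom_def)
  obtain s1 s2 where s: "linear_section (mpG X) (mpG M) (proj1 X) s1"
      "linear_section (mpH X) (mpH M) (proj2 X) s2"
    and eqs: "\<forall>x\<in>carr (mpG M). \<forall>h\<in>carr (mpH M). \<forall>v w.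
         incl1 X (rhoV R x v) = lbrack (mpG X) (s1 x) (incl1 X v) \<and>
         incl2 X (rhoW R x w) = mprho X (s1 x) (incl2 X w) \<and>
         incl1 X (psiV R h v) = mppsi X (s2 h) (incl1 X v) \<and>
         incl2 X (psiW R h w) = lbrack (mpH X) (s2 h) (incl2 X w) \<and>
         incl2 X (rep_alpha R v h) = mprho X (incl1 X v) (s2 h) \<and>
         incl1 X (rep_beta R w x) = mppsi X (incl2 X w) (s1 x)"
    using ind unfolding induces_rep_def by blast
  define f where "f = (\<lambda>(x, u). vadd (mpG X) (s1 x) (incl1 X u))"
  define g where "g = (\<lambda>(h, w). vadd (mpH X) (s2 h) (incl2 X w))"
  note f = section_splitting[OF on_type(1) on_type_abelian_lie vsM(1,3) vsX(1) ex(1) lin(1,3) s(1),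
      folded f_def, simplified]
  note g = section_splitting[OF on_type(2) on_type_abelian_lie vsM(2,4) vsX(2) ex(2) lin(2,4) s(2),
      folded g_def, simplified]
  define Y where "Y = pull_ext UNIV f UNIV g X"
  have Y: "Y \<in> extensions M R" and iso: "ext_iso Y X f g"
    using pull_ext_extensions[OF X f(1) g(1)] by (simp_all add: Y_def)
  have fi [simp]: "inv_into UNIV f (f p) = p" for p
    using f(1) by (simp add: bij_betw_def)
  have gi [simp]: "inv_into UNIV g (g p) = p" for p
    using g(1) by (simp add: bij_betw_def)
  \<comment> \<open>Only the vector space operations are claimed to be those of the product; the
    bracket is left open, and the twist is read off from it later.\<close>
  have "mpG Y = prod_lie (mpG M) sv (lbrack (mpG Y))"
    unfolding Y_def pull_ext_simps
    by (intro lie_data.equality) (simp_all add: fun_eq_iff flip: f(2,3,4))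
  moreover have "mpH Y = prod_lie (mpH M) sw (lbrack (mpH Y))"
    unfolding Y_def pull_ext_simps
    by (intro lie_data.equality) (simp_all add: fun_eq_iff flip: g(2,3,4))
  moreover have "incl1 Y = (\<lambda>v. (0, v))" "incl2 Y = (\<lambda>w. (0, w))" "proj1 Y = fst" "proj2 Y = fst"
    by (simp_all add: Y_def fun_eq_iff f(7) g(7) flip: f(6) g(6))
  moreover have "lbrack (mpG Y) (x, 0) (0, v) = (0, \<rho>V x v)"
      "lbrack (mpH Y) (h, 0) (0, w) = (0, \<psi>W h w)"
      "mprho Y (x, 0) (0, w) = (0, \<rho>W x w)" "mprho Y (0, v) (h, 0) = (0, \<alpha> v h)"
      "mppsi Y (h, 0) (0, v) = (0, \<psi>V h v)" "mppsi Y (0, w) (x, 0) = (0, \<beta> w x)" for x h v w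
  proof -
    have "lbrack (mpG X) (f (x, 0)) (f (0, v)) = f (0, \<rho>V x v)"
      "lbrack (mpH X) (g (h, 0)) (g (0, w)) = g (0, \<psi>W h w)"
      "mprho X (f (x, 0)) (g (0, w)) = g (0, \<rho>W x w)" "mprho X (f (0, v)) (g (h, 0)) = g (0, \<alpha> v h)"
      "mppsi X (g (h, 0)) (f (0, v)) = f (0, \<psi>V h v)" "mppsi X (g (0, w)) (f (x, 0)) = f (0, \<beta> w x)"
      unfolding f(5,6) g(5,6) using eqs by simp_all
    then show "lbrack (mpG Y) (x, 0) (0, v) = (0, \<rho>V x v)"
      "lbrack (mpH Y) (h, 0) (0, w) = (0, \<psi>W h w)"
      "mprho Y (x, 0) (0, w) = (0, \<rho>W x w)" "mprho Y (0, v) (h, 0) = (0, \<alpha> v h)"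
      "mppsi Y (h, 0) (0, v) = (0, \<psi>V h v)" "mppsi Y (0, w) (x, 0) = (0, \<beta> w x)"
      by (simp_all add: Y_def)
  qed
  moreover have mpY: "matched_pair Y" "mp_hom Y M (proj1 Y) (proj2 Y)"
    "mp_hom (abelian_mp R) Y (incl1 Y) (incl2 Y)"
    using Y by (simp_all add: extensions_def abelian_extension_def)
  ultimately obtain a b c d where abcd: "cochain_maps a b c d" "Y = std_ext M R a b c d"
    using eq_std_ext[OF mpY] by metis
  then show ?thesis
    using iso mpY(1) matched_pair_std_ext_iff[OF abcd(1)] by blast
qed

section \<open>Isomorphisms of twisted products\<close>

text \<open>The right-hand sides are the four components of the coboundary of the 1-cochain
  \<open>(p, q)\<close>, as \<open>delta_MPL_cochain1\<close> confirms. In this form they can be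
  compared with isomorphisms without any shuffles.\<close>

definition cohomologous_via where
  "cohomologous_via p q a b c d a' b' c' d' \<longleftrightarrow>
     linear_on (mpG M) (abelian_lie sv) p \<and> linear_on (mpH M) (abelian_lie sw) q \<and>
     (\<forall>x y. a x y - a' x y = \<rho>V x (p y) - \<rho>V y (p x) - p (bg x y)) \<and>
     (\<forall>x h. b x h - b' x h = p (\<psi> h x) - \<psi>V h (p x) - \<beta> (q h) x) \<and>
     (\<forall>x h. c x h - c' x h = \<rho>W x (q h) + \<alpha> (p x) h - q (\<rho> x h)) \<and>
     (\<forall>h k. d h k - d' h k = \<psi>W h (q k) - \<psi>W k (q h) - q (bh h k))"

lemma cohomologous_viaD:
  assumes pq: "cohomologous_via p q a b c d a' b' c' d'"
  shows "p (x + y) = p x + p y" "p (sg t x) = sv t (p x)" "p 0 = 0"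
    and "q (h + k) = q h + q k" "q (sh t h) = sw t (q h)" "q 0 = 0"
    and "a x y = a' x y + (\<rho>V x (p y) - \<rho>V y (p x) - p (bg x y))"
    and "b x h = b' x h + (p (\<psi> h x) - \<psi>V h (p x) - \<beta> (q h) x)"
    and "c x h = c' x h + (\<rho>W x (q h) + \<alpha> (p x) h - q (\<rho> x h))"
    and "d h k = d' h k + (\<psi>W h (q k) - \<psi>W k (q h) - q (bh h k))"
proof -
  show *: "p (x + y) = p x + p y" "p (sg t x) = sv t (p x)"
    "q (h + k) = q h + q k" "q (sh t h) = sw t (q h)" for x y h k t
    using pq by (simp_all add: cohomologous_via_def linear_on_on_type on_type)
  show "p 0 = 0" "q 0 = 0" using *(1)[of 0 0] *(3)[of 0 0] by simp_all
  show "a x y = a' x y + (\<rho>V x (p y) - \<rho>V y (p x) - p (bg x y))"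
    "b x h = b' x h + (p (\<psi> h x) - \<psi>V h (p x) - \<beta> (q h) x)"
    "c x h = c' x h + (\<rho>W x (q h) + \<alpha> (p x) h - q (\<rho> x h))"
    "d h k = d' h k + (\<psi>W h (q k) - \<psi>W k (q h) - q (bh h k))"
    using pq unfolding cohomologous_via_def by (metis diff_eq_eq add.commute)+
qed

text \<open>Compatibility with the brackets and actions, tested on the zero sections, already gives
  all four equations. They suffice for arbitrary arguments because the coordinates in
  \<open>V\<close> and \<open>W\<close> enter both structures through the same linear terms.\<close>

lemma std_ext_iso_iff:
  assumes abcd: "cochain_maps a b c d" and abcd': "cochain_maps a' b' c' d'"
  shows "(\<exists>f g. ext_iso (std_ext M R a b c d) (std_ext M R a' b' c' d') f g) \<longleftrightarrow>
    (\<exists>p q. cohomologous_via p q a b c d a' b' c' d')"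
proof
  let ?X = "std_ext M R a b c d" and ?Y = "std_ext M R a' b' c' d'"
  assume "\<exists>f g. ext_iso ?X ?Y f g"
  then obtain f g where iso: "ext_iso ?X ?Y f g" by blast
  have hom: "mp_hom ?X ?Y f g" using iso by (simp add: ext_iso_def mp_iso_def)
  have f0: "f (0, u) = (0, u)" and g0: "g (0, w) = (0, w)"
    and fst: "fst (f r) = fst r" "fst (g z) = fst z" for u w r z
    using iso by (cases r; cases z; simp add: ext_iso_def)+
  have fadd: "f (r + r') = f r + f r'" "f (vscale (mpG ?X) t r) = vscale (mpG ?Y) t (f r)"
    and fbr: "f (lbrack (mpG ?X) r r') = lbrack (mpG ?Y) (f r) (f r')" for t r r'
    using hom unfolding mp_hom_def lie_hom_def by (cases r; cases r'; simp add: linear_on_def)+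
  have gadd: "g (z + z') = g z + g z'" "g (vscale (mpH ?X) t z) = vscale (mpH ?Y) t (g z)"
    and gbr: "g (lbrack (mpH ?X) z z') = lbrack (mpH ?Y) (g z) (g z')" for t z z'
    using hom unfolding mp_hom_def lie_hom_def by (cases z; cases z'; simp add: linear_on_def)+
  have rho: "g (mprho ?X r z) = mprho ?Y (f r) (g z)"
    and psi: "f (mppsi ?X z r) = mppsi ?Y (g z) (f r)" for r z
    using hom unfolding mp_hom_def by (cases r; cases z; simp)+
  define p where "p x = snd (f (x, 0))" for x
  define q where "q h = snd (g (h, 0))" for h
  have f: "f (x, u) = (x, u + p x)" for x u
  proof -
    have "f (x, u) = f (x, 0) + f (0, u)" by (simp flip: fadd)
    then show ?thesis by (simp add: f0 prod_eq_iff fst p_def add.commute)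
  qed
  have g: "g (h, w) = (h, w + q h)" for h w
  proof -
    have "g (h, w) = g (h, 0) + g (0, w)" by (simp flip: gadd)
    then show ?thesis by (simp add: g0 prod_eq_iff fst q_def add.commute)
  qed
  have "p (x + y) = p x + p y" "p (sg t x) = sv t (p x)" for x y t
    using fadd(1)[of "(x, 0)" "(y, 0)"] fadd(2)[of t "(x, 0)"] by (simp_all add: f scale_add)
  moreover have "q (h + k) = q h + q k" "q (sh t h) = sw t (q h)" for h k t
    using gadd(1)[of "(h, 0)" "(k, 0)"] gadd(2)[of t "(h, 0)"] by (simp_all add: g scale_add)
  moreover have "a x y - a' x y = \<rho>V x (p y) - \<rho>V y (p x) - p (bg x y)" for x y
    using fbr[of "(x, 0)" "(y, 0)"] by (simp add: f additive_structure algebra_simps)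
  moreover have "d h k - d' h k = \<psi>W h (q k) - \<psi>W k (q h) - q (bh h k)" for h k
    using gbr[of "(h, 0)" "(k, 0)"] by (simp add: g additive_structure algebra_simps)
  moreover have "b x h - b' x h = p (\<psi> h x) - \<psi>V h (p x) - \<beta> (q h) x" for x h
    using psi[of "(h, 0)" "(x, 0)"] by (simp add: f g additive_structure algebra_simps)
  moreover have "c x h - c' x h = \<rho>W x (q h) + \<alpha> (p x) h - q (\<rho> x h)" for x h
    using rho[of "(x, 0)" "(h, 0)"] by (simp add: f g additive_structure algebra_simps)
  ultimately have "cohomologous_via p q a b c d a' b' c' d'"
    by (simp add: cohomologous_via_def linear_on_on_type on_type)
  then show "\<exists>p q. cohomologous_via p q a b c d a' b' c' d'" by blast
next
  let ?X = "std_ext M R a b c d" and ?Y = "std_ext M R a' b' c' d'"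
  assume "\<exists>p q. cohomologous_via p q a b c d a' b' c' d'"
  then obtain p q where pq: "cohomologous_via p q a b c d a' b' c' d'" by blast
  note [simp] = cohomologous_viaD(1-6)[OF pq] and eqs = cohomologous_viaD(7-10)[OF pq]
  define f where "f = (\<lambda>(x, u). (x, u + p x))"
  define g where "g = (\<lambda>(h, w). (h, w + q h))"
  have "bij f" "bij g"
    by (rule o_bij[of "\<lambda>(x, u). (x, u - p x)"]; auto simp: f_def fun_eq_iff)
      (rule o_bij[of "\<lambda>(h, w). (h, w - q h)"]; auto simp: g_def fun_eq_iff)
  moreover have "mp_hom ?X ?Y f g"
    by (auto simp: mp_hom_def lie_hom_def linear_on_def f_def g_def eqs scale_add
        additive_structure algebra_simps)
  ultimately have "ext_iso ?X ?Y f g"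
    by (auto simp: ext_iso_def mp_iso_def f_def g_def)
  then show "\<exists>f g. ext_iso ?X ?Y f g" by blast
qed

end

section \<open>Cochains of low degree\<close>

lemma strict_mono_on_small:
  "strict_mono_on {} \<sigma>" "strict_mono_on {n} \<sigma>"
  "strict_mono_on {..<2::nat} \<tau> \<longleftrightarrow> \<tau> 0 < \<tau> (Suc 0)"
  for \<sigma> :: "'a::linorder \<Rightarrow> 'b::linorder" and \<tau> :: "nat \<Rightarrow> nat"
  by (auto simp: strict_mono_on_def less_Suc_eq numeral_2_eq_2)

lemma shuffles_set_small:
  "shuffles_set 1 0 = {id}" "shuffles_set 0 1 = {id}" "shuffles_set 2 0 = {id}" "shuffles_set 0 2 = {id}"
  "shuffles_set 1 1 = {id, transpose 0 1}"
proof -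
  have sets: "{..<Suc 0} = {0}" "{0..<Suc 0} = {0}" "{0..<2::nat} = {..<2}" "{Suc 0..<2} = {Suc 0}"
    by auto
  have "{..<2::nat} = {0, Suc 0}" by auto
  then have p: "\<sigma> permutes {..<2} \<longleftrightarrow> \<sigma> = id \<or> \<sigma> = transpose 0 (Suc 0)" for \<sigma> :: "nat \<Rightarrow> nat"
    using permutes_doubleton_iff[of \<sigma> 0 "Suc 0"] by simp
  show "shuffles_set 1 0 = {id}" "shuffles_set 0 1 = {id}" "shuffles_set 2 0 = {id}"
    "shuffles_set 0 2 = {id}" "shuffles_set 1 1 = {id, transpose 0 1}"
    unfolding shuffles_set_def
    by (auto simp: strict_mono_on_small sets p permutes_sing simp flip: numeral_2_eq_2)
qed

text \<open>The value at \<open>2\<close> determines such a shuffle, since the other two values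
  follow in increasing order. The values \<open>2\<close>, \<open>1\<close>, \<open>0\<close> give
  the three listed permutations, with signs \<open>+\<close>, \<open>-\<close>,
  \<open>+\<close>.\<close>

lemma shuffles_set_2_1: "shuffles_set 2 1 = {id, transpose 1 2, transpose 0 1 \<circ> transpose 1 2}"
proof (intro equalityI subsetI)
  fix \<sigma> assume "\<sigma> \<in> shuffles_set 2 1"
  then have p: "\<sigma> permutes {..<3}" and m: "\<sigma> 0 < \<sigma> 1"
    by (auto simp: shuffles_set_def strict_mono_on_small)
  have out: "\<sigma> n = n" if "n \<noteq> 0" "n \<noteq> 1" "n \<noteq> 2" for n
    using p that by (auto simp: permutes_def)
  have ran: "\<sigma> n = 0 \<or> \<sigma> n = 1 \<or> \<sigma> n = 2" if "n < 3" for n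
    using permutes_in_image[OF p, of n] that by auto
  have inj: "\<sigma> i = \<sigma> j \<longleftrightarrow> i = j" for i j
    using permutes_inj[OF p] by (auto dest: injD)
  have "\<sigma> 2 = 2 \<and> \<sigma> 1 = 1 \<and> \<sigma> 0 = 0 \<or> \<sigma> 2 = 1 \<and> \<sigma> 1 = 2 \<and> \<sigma> 0 = 0 \<or> \<sigma> 2 = 0 \<and> \<sigma> 1 = 2 \<and> \<sigma> 0 = 1"
    using ran[of 0] ran[of 1] ran[of 2] m inj[of 0 1] inj[of 0 2] inj[of 1 2] by auto
  then show "\<sigma> \<in> {id, transpose 1 2, transpose 0 1 \<circ> transpose 1 2}"
  proof (elim disjE conjE)
    assume "\<sigma> 2 = 2" "\<sigma> 1 = 1" "\<sigma> 0 = 0"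
    then have "\<sigma> n = n" for n using out[of n] by (cases "n = 0 \<or> n = 1 \<or> n = 2") auto
    then have "\<sigma> = id" by (simp add: fun_eq_iff)
    then show ?thesis by simp
  next
    assume "\<sigma> 2 = 1" "\<sigma> 1 = 2" "\<sigma> 0 = 0"
    then have "\<sigma> n = transpose 1 2 n" for n
      using out[of n] by (cases "n = 0 \<or> n = 1 \<or> n = 2") (auto simp: transpose_def)
    then have "\<sigma> = transpose 1 2" by (simp add: fun_eq_iff)
    then show ?thesis by simp
  next
    assume "\<sigma> 2 = 0" "\<sigma> 1 = 2" "\<sigma> 0 = 1"
    then have "\<sigma> n = (transpose 0 1 \<circ> transpose 1 2) n" for n
      using out[of n] by (cases "n = 0 \<or> n = 1 \<or> n = 2") (auto simp: transpose_def)
    then have "\<sigma> = transpose 0 1 \<circ> transpose 1 2" by (simp add: fun_eq_iff)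
    then show ?thesis by simp
  qed
next
  fix \<sigma> :: "nat \<Rightarrow> nat" assume "\<sigma> \<in> {id, transpose 1 2, transpose 0 1 \<circ> transpose 1 2}"
  moreover have "transpose 1 2 permutes {..<3::nat}" "transpose 0 1 permutes {..<3::nat}"
    by (auto intro!: permutes_swap_id)
  moreover have "{2..<3} = {2::nat}" by auto
  ultimately show "\<sigma> \<in> shuffles_set 2 1"
    by (auto simp: shuffles_set_def strict_mono_on_small permutes_id permutes_compose transpose_def[abs_def]
        simp del: One_nat_def simp flip: One_nat_def intro: permutes_compose)
qed

lemma lift_hom_small:
  "lift_hom 1 0 A [z] = A [fst z] []" "lift_hom 0 1 A [z] = A [] [snd z]"
  "lift_hom 2 0 A [z, z'] = A [fst z, fst z'] []" "lift_hom 0 2 A [z, z'] = A [] [snd z, snd z']"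
  "lift_hom 1 1 A [z, z'] = A [fst z] [snd z'] - A [fst z'] [snd z]"
proof -
  have "id \<noteq> transpose 0 (1::nat)" by (metis id_apply transpose_apply_first zero_neq_one)
  then show "lift_hom 1 0 A [z] = A [fst z] []" "lift_hom 0 1 A [z] = A [] [snd z]"
    "lift_hom 2 0 A [z, z'] = A [fst z, fst z'] []" "lift_hom 0 2 A [z, z'] = A [] [snd z, snd z']"
    "lift_hom 1 1 A [z, z'] = A [fst z] [snd z'] - A [fst z'] [snd z]"
    unfolding lift_hom_def shuffles_set_small
    by (simp_all add: signed_def pick_def evenperm_id evenperm_swap upt_rec numeral_2_eq_2)
qed

lemma insertion_small:
  "insertion 1 0 f g [z1, z2] = g [f [z1, z2]]"
  "insertion 0 1 f g [z1, z2] = g [f [z1], z2] - g [f [z2], z1]"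
  "insertion 1 1 f g [z1, z2, z3] = g [f [z1, z2], z3] - g [f [z1, z3], z2] + g [f [z2, z3], z1]"
proof -
  \<comment> \<open>Distinctness of the permutations makes the sum over the enumerated set of
    shuffles have one term for each of them.\<close>
  have 1: "id \<noteq> transpose 0 (1::nat)" by (metis id_apply transpose_apply_first zero_neq_one)
  have 2: "id \<noteq> transpose 1 (2::nat)" by (metis id_apply transpose_apply_first numeral_One numeral_eq_iff num.distinct(1))
  have 3: "(transpose 0 1 \<circ> transpose 1 2) 2 = (0::nat)" "transpose 1 2 (2::nat) = 1" "id (2::nat) = 2"
    by (simp_all add: transpose_def)
  have 4: "transpose 0 1 \<circ> transpose 1 2 \<noteq> (id :: nat \<Rightarrow> nat)"
    "transpose 0 1 \<circ> transpose 1 2 \<noteq> transpose 1 (2::nat)"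
    using 3 by (metis zero_neq_numeral, metis zero_neq_one)
  have 5: "\<not> evenperm (transpose 1 (2::nat))" "evenperm (transpose 0 1 \<circ> transpose 1 (2::nat))"
    "\<not> evenperm (transpose 0 (1::nat))"
    by (simp_all add: evenperm_swap evenperm_comp permutation_swap_id)
  show "insertion 1 0 f g [z1, z2] = g [f [z1, z2]]"
    by (simp add: insertion_def shuffles_set_small signed_def pick_def evenperm_id upt_rec
        flip: numeral_2_eq_2)
  show "insertion 0 1 f g [z1, z2] = g [f [z1], z2] - g [f [z2], z1]"
    using 1 5 by (simp add: insertion_def shuffles_set_small signed_def pick_def evenperm_id upt_rec
        flip: One_nat_def)
  have s3: "shuffles_set (1 + 1) 1 = {id, transpose 1 2, transpose 0 1 \<circ> transpose 1 2}"
    using shuffles_set_2_1 unfolding one_add_one .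
  have p: "pick \<sigma> 0 (1 + 1) [z1, z2, z3] = [[z1, z2, z3] ! \<sigma> 0, [z1, z2, z3] ! \<sigma> 1]"
    "pick \<sigma> (1 + 1) (1 + 1 + 1) [z1, z2, z3] = [[z1, z2, z3] ! \<sigma> 2]" for \<sigma>
    by (simp_all add: pick_def upt_rec numeral_2_eq_2)
  show "insertion 1 1 f g [z1, z2, z3] = g [f [z1, z2], z3] - g [f [z1, z3], z2] + g [f [z2, z3], z1]"
    unfolding insertion_def s3 p using 2 4 5
    by (simp add: signed_def evenperm_id transpose_def)
qed

text \<open>Coordinates on \<open>C^1\<close>. The value \<open>0\<close> on lists of other lengths
  is the default of \<open>lift_hom\<close> and \<open>insertion\<close>, so cochains can be
  compared as functions on all lists.\<close>

definition cochain1 ::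
  "('g \<Rightarrow> 'v) \<Rightarrow> ('h \<Rightarrow> 'w) \<Rightarrow>
   ('g::ab_group_add, 'h::ab_group_add, 'v::ab_group_add, 'w::ab_group_add) total list \<Rightarrow>
   ('g, 'h, 'v, 'w) total" where
  "cochain1 p q zs = (if length zs = 1
     then (let ((x, u), (h, w)) = zs ! 0 in ((0, p x), (0, q h))) else 0)"

text \<open>The negative terms come from the shuffle that moves the \<open>\<gg>\<close>-argument to the front.\<close>

definition cochain2 ::
  "('g \<Rightarrow> 'g \<Rightarrow> 'v) \<Rightarrow> ('g \<Rightarrow> 'h \<Rightarrow> 'v) \<Rightarrow> ('g \<Rightarrow> 'h \<Rightarrow> 'w) \<Rightarrow> ('h \<Rightarrow> 'h \<Rightarrow> 'w) \<Rightarrow>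
   ('g::ab_group_add, 'h::ab_group_add, 'v::ab_group_add, 'w::ab_group_add) total list \<Rightarrow>
   ('g, 'h, 'v, 'w) total" where
  "cochain2 a b c d zs = (if length zs = 2
     then (let ((x, u), (h, w)) = zs ! 0; ((y, v), (k, w')) = zs ! 1
           in ((0, a x y + b x k - b y h), (0, d h k + c x k - c y h))) else 0)"

lemma cochain1_simps [simp]:
  "cochain1 p q [((x, u), (h, w))] = ((0, p x), (0, q h))"
  "length zs \<noteq> 1 \<Longrightarrow> cochain1 p q zs = 0"
  by (simp_all add: cochain1_def)

lemma cochain2_simps [simp]:
  "cochain2 a b c d [((x, u), (h, w)), ((y, v), (k, w'))]
    = ((0, a x y + b x k - b y h), (0, d h k + c x k - c y h))"
  "length zs \<noteq> 2 \<Longrightarrow> cochain2 a b c d zs = 0"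
  by (simp_all add: cochain2_def)

lemma length_1_total:
  fixes zs :: "('g, 'h, 'v, 'w) total list"
  assumes "length zs = 1"
  obtains x u h w where "zs = [((x, u), (h, w))]"
  using assms by (auto simp: length_Suc_conv)

lemma length_2_total:
  fixes zs :: "('g, 'h, 'v, 'w) total list"
  assumes "length zs = 2"
  obtains x u h w y v k w' where "zs = [((x, u), (h, w)), ((y, v), (k, w'))]"
  using assms by (auto simp: length_Suc_conv numeral_2_eq_2)

lemma length_3_total:
  fixes zs :: "('g, 'h, 'v, 'w) total list"
  assumes "length zs = 3"
  obtains x1 u1 h1 w1 x2 u2 h2 w2 x3 u3 h3 w3
  where "zs = [((x1, u1), (h1, w1)), ((x2, u2), (h2, w2)), ((x3, u3), (h3, w3))]"
  using assms by (auto simp: length_Suc_conv numeral_3_eq_3)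

lemma extend_lift_hom_1:
  "extend (\<lambda>zs. \<Sum>k<1. lift_hom (k + 1) (1 - 1 - k) (A k) zs)
     (\<lambda>zs. \<Sum>k<1. lift_hom k (1 - 1 - k + 1) (B k) zs)
   = cochain1 (\<lambda>x. A 0 [x] []) (\<lambda>h. B 0 [] [h])" (is "?L = ?R")
proof
  fix zs show "?L zs = ?R zs"
  proof (cases "length zs = 1")
    case True
    then obtain x u h w where "zs = [((x, u), (h, w))]" by (rule length_1_total)
    then show ?thesis
      by (simp add: extend_def Let_def lift_hom_small[unfolded One_nat_def])
  next
    case False
    then show ?thesis by (simp add: extend_def lift_hom_def Let_def zero_prod_def)
  qed
qed

text \<open>The index is the \<open>k\<close> of \<open>C^{k|l}\<close> with
  \<open>l = 1 - k\<close>: \<open>k = 1\<close> carries \<open>a\<close> and \<open>c\<close>, and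
  \<open>k = 0\<close> carries \<open>b\<close> and \<open>d\<close>.\<close>

lemma extend_lift_hom_2:
  "extend (\<lambda>zs. \<Sum>k<2. lift_hom (k + 1) (2 - 1 - k) (A k) zs)
     (\<lambda>zs. \<Sum>k<2. lift_hom k (2 - 1 - k + 1) (B k) zs)
   = cochain2 (\<lambda>x y. A 1 [x, y] []) (\<lambda>x h. A 0 [x] [h]) (\<lambda>x h. B 1 [x] [h]) (\<lambda>h k. B 0 [] [h, k])"
  (is "?L = ?R")
proof
  fix zs show "?L zs = ?R zs"
  proof (cases "length zs = 2")
    case True
    then obtain x u h w y v k w' where "zs = [((x, u), (h, w)), ((y, v), (k, w'))]"
      by (rule length_2_total)
    then show ?thesis
      by (simp add: extend_def Let_def numeral_2_eq_2 lift_hom_small[unfolded numeral_2_eq_2 One_nat_def])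
  next
    case False
    then show ?thesis by (simp add: extend_def lift_hom_def Let_def zero_prod_def)
  qed
qed

context mp_rep_on_type begin

lemma linear_iff:
  "Vector_Spaces.linear sg sv f \<longleftrightarrow> linear_on (mpG M) (abelian_lie sv) f"
  "Vector_Spaces.linear sg sw f' \<longleftrightarrow> linear_on (mpG M) (abelian_lie sw) f'"
  "Vector_Spaces.linear sh sv g \<longleftrightarrow> linear_on (mpH M) (abelian_lie sv) g"
  "Vector_Spaces.linear sh sw g' \<longleftrightarrow> linear_on (mpH M) (abelian_lie sw) g'"
  by (simp_all add: Vector_Spaces.linear_iff vector_spaces linear_on_on_type on_type)

text \<open>Lists of a fixed length are tuples. Alternation is vacuous in a group of at most one
  argument and is a single condition in a group of two.\<close>

lemma alt_hom_small:
  "A \<in> alt_hom sg sh sv 1 0 \<longleftrightarrow> linear_on (mpG M) (abelian_lie sv) (\<lambda>x. A [x] [])"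
  "B \<in> alt_hom sg sh sw 0 1 \<longleftrightarrow> linear_on (mpH M) (abelian_lie sw) (\<lambda>h. B [] [h])"
  "A \<in> alt_hom sg sh sv 1 1 \<longleftrightarrow> bilinear_on (mpG M) (mpH M) (abelian_lie sv) (\<lambda>x h. A [x] [h])"
  "B \<in> alt_hom sg sh sw 1 1 \<longleftrightarrow> bilinear_on (mpG M) (mpH M) (abelian_lie sw) (\<lambda>x h. B [x] [h])"
  "A \<in> alt_hom sg sh sv 2 0 \<longleftrightarrow>
    bilinear_on (mpG M) (mpG M) (abelian_lie sv) (\<lambda>x y. A [x, y] []) \<and> (\<forall>x. A [x, x] [] = 0)"
  "B \<in> alt_hom sg sh sw 0 2 \<longleftrightarrow>
    bilinear_on (mpH M) (mpH M) (abelian_lie sw) (\<lambda>h k. B [] [h, k]) \<and> (\<forall>h. B [] [h, h] = 0)"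
proof -
  have all_length: "(\<forall>xs. length xs = 0 \<longrightarrow> P xs) \<longleftrightarrow> P []"
    "(\<forall>xs. length xs = Suc n \<longrightarrow> P xs) \<longleftrightarrow> (\<forall>x xs. length xs = n \<longrightarrow> P (x # xs))"
    for P :: "'z list \<Rightarrow> bool" and n
    by (auto simp: length_Suc_conv)
  have all_length2: "(\<forall>xs ys. length xs = p \<and> length ys = q \<longrightarrow> P xs ys) \<longleftrightarrow>
      (\<forall>xs. length xs = p \<longrightarrow> (\<forall>ys. length ys = q \<longrightarrow> P xs ys))"
    for P :: "'y list \<Rightarrow> 'z list \<Rightarrow> bool" and p q by auto
  note unfold = alt_hom_def linear_iff mem_Collect_eq all_length2 numeral_2_eq_2 One_nat_def all_length
  have G: "carr (mpG M) = UNIV" "carr (mpH M) = UNIV" by simp_all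
  show "A \<in> alt_hom sg sh sv 1 0 \<longleftrightarrow> linear_on (mpG M) (abelian_lie sv) (\<lambda>x. A [x] [])"
    "B \<in> alt_hom sg sh sw 0 1 \<longleftrightarrow> linear_on (mpH M) (abelian_lie sw) (\<lambda>h. B [] [h])"
    "A \<in> alt_hom sg sh sv 1 1 \<longleftrightarrow> bilinear_on (mpG M) (mpH M) (abelian_lie sv) (\<lambda>x h. A [x] [h])"
    "B \<in> alt_hom sg sh sw 1 1 \<longleftrightarrow> bilinear_on (mpG M) (mpH M) (abelian_lie sw) (\<lambda>x h. B [x] [h])"
    "A \<in> alt_hom sg sh sv 2 0 \<longleftrightarrow>
      bilinear_on (mpG M) (mpG M) (abelian_lie sv) (\<lambda>x y. A [x, y] []) \<and> (\<forall>x. A [x, x] [] = 0)"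
    "B \<in> alt_hom sg sh sw 0 2 \<longleftrightarrow>
      bilinear_on (mpH M) (mpH M) (abelian_lie sw) (\<lambda>h k. B [] [h, k]) \<and> (\<forall>h. B [] [h, h] = 0)"
    unfolding unfold bilinear_on_def G by (auto simp: All_less_Suc)
qed

lemma cochains_1: "F \<in> cochains M R 1 \<longleftrightarrow>
  (\<exists>p q. linear_on (mpG M) (abelian_lie sv) p \<and> linear_on (mpH M) (abelian_lie sw) q \<and> F = cochain1 p q)"
proof
  assume "F \<in> cochains M R 1"
  then obtain A B where F: "F = cochain1 (\<lambda>x. A (0::nat) [x] []) (\<lambda>h. B (0::nat) [] [h])"
    and "A 0 \<in> alt_hom sg sh sv 1 0" "B 0 \<in> alt_hom sg sh sw 0 1"
    unfolding cochains_def extend_lift_hom_1 by auto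
  then show "\<exists>p q. linear_on (mpG M) (abelian_lie sv) p \<and> linear_on (mpH M) (abelian_lie sw) q \<and> F = cochain1 p q"
    using alt_hom_small(1,2) by blast
next
  assume "\<exists>p q. linear_on (mpG M) (abelian_lie sv) p \<and> linear_on (mpH M) (abelian_lie sw) q \<and> F = cochain1 p q"
  then obtain p q where pq: "linear_on (mpG M) (abelian_lie sv) p" "linear_on (mpH M) (abelian_lie sw) q"
    and F: "F = cochain1 p q" by blast
  define A where "A = (\<lambda>(_::nat) xs (_::'h list). p (xs ! 0))"
  define B where "B = (\<lambda>(_::nat) (_::'g list) ys. q (ys ! 0))"
  have "A 0 \<in> alt_hom sg sh sv 1 0" "B 0 \<in> alt_hom sg sh sw 0 1"
    "F = cochain1 (\<lambda>x. A 0 [x] []) (\<lambda>h. B 0 [] [h])"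
    using pq by (simp_all only: alt_hom_small) (simp_all add: A_def B_def F)
  then show "F \<in> cochains M R 1"
    unfolding cochains_def extend_lift_hom_1 by auto
qed

lemma cochains_2: "F \<in> cochains M R 2 \<longleftrightarrow> (\<exists>a b c d. cochain_maps a b c d \<and> F = cochain2 a b c d)"
proof -
  have less_2: "(\<forall>k<2. P k) \<longleftrightarrow> P 0 \<and> P 1" for P :: "nat \<Rightarrow> bool"
    by (auto simp: less_2_cases_iff)
  have "F \<in> cochains M R 2 \<longleftrightarrow> (\<exists>A B. F = cochain2 (\<lambda>x y. A (1::nat) [x, y] []) (\<lambda>x h. A 0 [x] [h])
      (\<lambda>x h. B (1::nat) [x] [h]) (\<lambda>h k. B 0 [] [h, k]) \<and>
      A 0 \<in> alt_hom sg sh sv 1 1 \<and> B 0 \<in> alt_hom sg sh sw 0 2 \<and>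
      A 1 \<in> alt_hom sg sh sv 2 0 \<and> B 1 \<in> alt_hom sg sh sw 1 1)"
    unfolding cochains_def extend_lift_hom_2 less_2 by (simp del: One_nat_def) (simp only: One_nat_def)
  also have "\<dots> \<longleftrightarrow> (\<exists>a b c d. cochain_maps a b c d \<and> F = cochain2 a b c d)" (is "?L \<longleftrightarrow> ?R")
  proof
    assume ?L
    then show ?R unfolding alt_hom_small cochain_maps_def by blast
  next
    assume ?R
    then obtain a b c d where abcd: "cochain_maps a b c d" and F: "F = cochain2 a b c d" by blast
    show ?L
      by (rule exI[of _ "\<lambda>k. if k = 0 then (\<lambda>xs ys. b (xs ! 0) (ys ! 0)) else (\<lambda>xs ys. a (xs ! 0) (xs ! 1))"],
          rule exI[of _ "\<lambda>k. if k = 0 then (\<lambda>xs ys. d (ys ! 0) (ys ! 1)) else (\<lambda>xs ys. c (xs ! 0) (ys ! 0))"])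
        (use abcd in \<open>simp add: alt_hom_small[unfolded One_nat_def] cochain_maps_def F\<close>)
  qed
  finally show ?thesis .
qed

section \<open>Coboundaries in degrees one and two\<close>

text \<open>Here \<open>m * n = 0\<close>, so the coboundary of \<open>F\<close> at
  \<open>z1\<close>, \<open>z2\<close> is
  \<open>Pi (F z1, z2) - Pi (F z2, z1) - F (Pi (z1, z2))\<close>. The four components arise by
  sorting the terms by the types of their arguments.\<close>

lemma delta_MPL_cochain1:
  assumes "linear_on (mpG M) (abelian_lie sv) p" "linear_on (mpH M) (abelian_lie sw) q"
  shows "delta_MPL M R 1 (cochain1 p q) = cochain2
    (\<lambda>x y. \<rho>V x (p y) - \<rho>V y (p x) - p (bg x y)) (\<lambda>x h. p (\<psi> h x) - \<psi>V h (p x) - \<beta> (q h) x)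
    (\<lambda>x h. \<rho>W x (q h) + \<alpha> (p x) h - q (\<rho> x h)) (\<lambda>h k. \<psi>W h (q k) - \<psi>W k (q h) - q (bh h k))"
  (is "?L = ?R")
proof
  have p: "additive p" and q: "additive q"
    using assms by (auto intro!: additive.intro simp: linear_on_on_type on_type)
  note pq = additive.add[OF p] additive.diff[OF p] additive.add[OF q] additive.diff[OF q]
  fix zs :: "('g, 'h, 'v, 'w) total list"
  show "?L zs = ?R zs"
  proof (cases "length zs = 2")
    case True
    then obtain x u h w y v k w' where zs: "zs = [((x, u), (h, w)), ((y, v), (k, w'))]"
      by (rule length_2_total)
    show ?thesis
      unfolding delta_MPL_def nr_bracket_def zs diff_self_eq_0 insertion_small
      by (simp add: Pi_map_def total_bracket_def additive_structure pq algebra_simps)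
  next
    case False
    then show ?thesis by (simp add: delta_MPL_def nr_bracket_def insertion_def)
  qed
qed

lemma coboundary_iff:
  assumes abcd: "cochain_maps a b c d" and abcd': "cochain_maps a' b' c' d'"
  shows "(\<lambda>zs. cochain2 a b c d zs - cochain2 a' b' c' d' zs) \<in> delta_MPL M R 1 ` cochains M R 1 \<longleftrightarrow>
    (\<exists>p q. cohomologous_via p q a b c d a' b' c' d')"
proof -
  note D = cochain_mapsD[OF abcd] and D' = cochain_mapsD[OF abcd']
  note lin = additive_structure biadditive_simps[OF D(1)] biadditive_simps[OF D(2)]
    biadditive_simps[OF D(3)] biadditive_simps[OF D(4)] biadditive_simps[OF D'(1)]
    biadditive_simps[OF D'(2)] biadditive_simps[OF D'(3)] biadditive_simps[OF D'(4)]
  have "(\<lambda>zs. cochain2 a b c d zs - cochain2 a' b' c' d' zs) = delta_MPL M R 1 (cochain1 p q) \<longleftrightarrow>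
      cohomologous_via p q a b c d a' b' c' d'"
    if pq: "linear_on (mpG M) (abelian_lie sv) p" "linear_on (mpH M) (abelian_lie sw) q" for p q
  proof
    have p0: "p 0 = 0" and q0: "q 0 = 0"
      using pq by (auto simp: linear_on_on_type on_type dest!: conjunct1 spec[of _ 0])
    assume eq: "(\<lambda>zs. cochain2 a b c d zs - cochain2 a' b' c' d' zs) = delta_MPL M R 1 (cochain1 p q)"
    have ev: "(cochain2 a b c d zs - cochain2 a' b' c' d' zs) = delta_MPL M R 1 (cochain1 p q) zs"
      if "zs = [((x, 0), (h, 0)), ((y, 0), (k, 0))]" for zs x h y k
      using fun_cong[OF eq] .
    note ev = ev[OF refl, unfolded delta_MPL_cochain1[OF pq] cochain2_simps diff_Pair prod.inject]
    \<comment> \<open>Zero arguments isolate the components: two arguments from \<open>\<gg>\<close>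
      give \<open>a\<close>, one from \<open>\<gg>\<close> and one from \<open>\<hh>\<close> give
      \<open>b\<close> and \<open>c\<close>, and two from \<open>\<hh>\<close> give
      \<open>d\<close>.\<close>
    show "cohomologous_via p q a b c d a' b' c' d'"
      using ev[where h = 0 and k = 0] ev[where h = 0 and y = 0] ev[where x = 0 and y = 0]
      by (simp add: cohomologous_via_def pq lin p0 q0)
  next
    assume eqs: "cohomologous_via p q a b c d a' b' c' d'"
    show "(\<lambda>zs. cochain2 a b c d zs - cochain2 a' b' c' d' zs) = delta_MPL M R 1 (cochain1 p q)"
      unfolding delta_MPL_cochain1[OF pq]
    proof
      fix zs :: "('g, 'h, 'v, 'w) total list"
      show "cochain2 a b c d zs - cochain2 a' b' c' d' zs = cochain2
        (\<lambda>x y. \<rho>V x (p y) - \<rho>V y (p x) - p (bg x y)) (\<lambda>x h. p (\<psi> h x) - \<psi>V h (p x) - \<beta> (q h) x)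
        (\<lambda>x h. \<rho>W x (q h) + \<alpha> (p x) h - q (\<rho> x h)) (\<lambda>h k. \<psi>W h (q k) - \<psi>W k (q h) - q (bh h k)) zs"
      proof (cases "length zs = 2")
        case True
        then obtain x u h w y v k w' where zs: "zs = [((x, u), (h, w)), ((y, v), (k, w'))]"
          by (rule length_2_total)
        then show ?thesis
          by (simp add: cohomologous_viaD(7-10)[OF eqs] algebra_simps)
      qed simp
    qed
  qed
  moreover have "linear_on (mpG M) (abelian_lie sv) p" "linear_on (mpH M) (abelian_lie sw) q"
    if "cohomologous_via p q a b c d a' b' c' d'" for p q
    using that by (simp_all add: cohomologous_via_def)
  ultimately show ?thesis
    unfolding image_iff Bex_def cochains_1 by blast
qed

text \<open>For \<open>m = n = 1\<close> the bracket of \<open>Pi\<close> and \<open>F\<close> is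
  the sum of both insertions, which is the part of the Jacobi expression of \<open>Pi + F\<close>
  that is linear in \<open>F\<close>. Each obstruction is summed, with shuffle signs, over the ways
  to choose which arguments supply their \<open>\<gg>\<close>-component and which their
  \<open>\<hh>\<close>-component; \<open>coc3\<close> and \<open>coc4\<close> carry an additional
  minus sign.\<close>

lemma delta_MPL_cochain2:
  assumes abcd: "cochain_maps a b c d"
  shows "delta_MPL M R 2 (cochain2 a b c d)
      [((x1, u1), (h1, w1)), ((x2, u2), (h2, w2)), ((x3, u3), (h3, w3))] =
    ((0, coc1 a x1 x2 x3 + coc6 a b c h3 x1 x2 - coc6 a b c h2 x1 x3 + coc6 a b c h1 x2 x3
         - coc4 b d h2 h3 x1 + coc4 b d h1 h3 x2 - coc4 b d h1 h2 x3),
     (0, coc2 d h1 h2 h3 - coc3 a c x1 x2 h3 + coc3 a c x1 x3 h2 - coc3 a c x2 x3 h1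
         + coc5 b c d x1 h2 h3 - coc5 b c d x2 h1 h3 + coc5 b c d x3 h1 h2))"
proof -
  note D = cochain_mapsD[OF abcd]
  note lin = additive_structure biadditive_simps[OF D(1)] biadditive_simps[OF D(2)]
    biadditive_simps[OF D(3)] biadditive_simps[OF D(4)]
  have anti: "bg y x = - bg x y" "bh k h = - bh h k" for x y h k
    by (rule biadditive_alternating[OF bilinear_structure'(1)[THEN conjunct1] bracket_self(1)]
        biadditive_alternating[OF bilinear_structure'(2)[THEN conjunct1] bracket_self(2)])+
  have n: "2 - 1 = (1::nat)" by simp
  \<comment> \<open>The chosen instances of antisymmetry order the cyclic terms of
    \<open>coc1\<close> and \<open>coc2\<close> and put an inner bracket or action into a fixed
    slot, so that both sides agree term by term.\<close>
  show ?thesis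
    unfolding delta_MPL_def nr_bracket_def n insertion_small
    by (simp add: Pi_map_def total_bracket_def coc1_def coc2_def coc3_def coc4_def coc5_def coc6_def
        lin anti(1)[of x3 x1] anti(2)[of h3 h1] D(7)[of x3 x1] D(8)[of h3 h1]
        D(7)[of _ "bg _ _"] D(8)[of _ "bh _ _"] D(7)[of _ "\<psi> _ _"] D(8)[of _ "\<rho> _ _"]
        algebra_simps)
qed

text \<open>All obstructions vanish as soon as one of their arguments is zero. On three homogeneous
  arguments, therefore, each of the two components of the coboundary retains at most one of them,
  and the sum can vanish only if each obstruction does.\<close>

lemma delta_MPL_cochain2_eq_0_iff:
  assumes abcd: "cochain_maps a b c d"
  shows "delta_MPL M R 2 (cochain2 a b c d) = (\<lambda>_. 0) \<longleftrightarrow> cocycle_maps a b c d"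
proof
  note D = cochain_mapsD[OF abcd]
  note lin = additive_structure biadditive_simps[OF D(1)] biadditive_simps[OF D(2)]
    biadditive_simps[OF D(3)] biadditive_simps[OF D(4)]
  assume 0: "delta_MPL M R 2 (cochain2 a b c d) = (\<lambda>_. 0)"
  have V: "coc1 a x y z + coc6 a b c l x y - coc6 a b c k x z + coc6 a b c h y z
      - coc4 b d k l x + coc4 b d h l y - coc4 b d h k z = 0"
    and W: "coc2 d h k l - coc3 a c x y l + coc3 a c x z k - coc3 a c y z h
      + coc5 b c d x k l - coc5 b c d y h l + coc5 b c d z h k = 0" for x y z h k l
    using fun_cong[OF 0, of "[((x, 0), (h, 0)), ((y, 0), (k, 0)), ((z, 0), (l, 0))]"]
    unfolding delta_MPL_cochain2[OF abcd] by (simp_all add: zero_prod_def)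
  have z: "coc1 a 0 y z = 0" "coc1 a x 0 z = 0" "coc1 a x y 0 = 0"
    "coc2 d 0 k l = 0" "coc2 d h 0 l = 0" "coc2 d h k 0 = 0"
    "coc3 a c 0 y h = 0" "coc3 a c x 0 h = 0" "coc3 a c x y 0 = 0"
    "coc4 b d 0 k x = 0" "coc4 b d h 0 x = 0" "coc4 b d h k 0 = 0"
    "coc5 b c d 0 h k = 0" "coc5 b c d x 0 k = 0" "coc5 b c d x h 0 = 0"
    "coc6 a b c 0 x y = 0" "coc6 a b c h 0 y = 0" "coc6 a b c h x 0 = 0" for x y z h k l
    by (simp_all add: coc1_def coc2_def coc3_def coc4_def coc5_def coc6_def lin)
  \<comment> \<open>In order, the six specialisations isolate \<open>coc1\<close>,
    \<open>coc6\<close>, \<open>coc4\<close> in \<open>V\<close> and \<open>coc2\<close>,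
    \<open>coc3\<close>, \<open>coc5\<close> in \<open>W\<close>.\<close>
  show "cocycle_maps a b c d"
    unfolding cocycle_maps_def
    using V[where h = 0 and k = 0 and l = 0] V[where z = 0 and h = 0 and k = 0]
      V[where y = 0 and z = 0 and h = 0] W[where x = 0 and y = 0 and z = 0]
      W[where z = 0 and h = 0 and k = 0] W[where y = 0 and z = 0 and h = 0]
    by (simp add: z)
next
  assume "cocycle_maps a b c d"
  then have 0: "delta_MPL M R 2 (cochain2 a b c d) [((x1, u1), (h1, w1)), ((x2, u2), (h2, w2)), ((x3, u3), (h3, w3))] = 0"
    for x1 u1 h1 w1 x2 u2 h2 w2 x3 u3 h3 w3
    unfolding delta_MPL_cochain2[OF abcd] cocycle_maps_def by (simp add: zero_prod_def)
  show "delta_MPL M R 2 (cochain2 a b c d) = (\<lambda>_. 0)"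
  proof
    fix zs :: "('g, 'h, 'v, 'w) total list"
    show "delta_MPL M R 2 (cochain2 a b c d) zs = 0"
    proof (cases "length zs = 3")
      case True
      then show ?thesis by (rule length_3_total) (simp only: 0)
    next
      case False
      then show ?thesis by (simp add: delta_MPL_def nr_bracket_def insertion_def)
    qed
  qed
qed

lemma cocycles2_iff:
  "F \<in> cocycles2 M R \<longleftrightarrow>
    (\<exists>a b c d. cochain_maps a b c d \<and> cocycle_maps a b c d \<and> F = cochain2 a b c d)"
  unfolding cocycles2_def mem_Collect_eq cochains_2 using delta_MPL_cochain2_eq_0_iff by blast

section \<open>The correspondence between cocycles and extensions\<close>

text \<open>An extension is related to every cocycle that arises from it in this way, and a cocycle
  to every extension isomorphic to its twisted product, so no section or carrier has to be
  fixed.\<close>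

definition realises ::
  "(('g, 'h, 'v, 'w) total list \<Rightarrow> ('g, 'h, 'v, 'w) total) \<Rightarrow>
   ('k, 'a, 'b, 'g, 'h, 'v, 'w) extension_data \<Rightarrow> bool" where
  "realises F X \<longleftrightarrow> (\<exists>a b c d f g. cochain_maps a b c d \<and> cocycle_maps a b c d \<and> F = cochain2 a b c d \<and>
     ext_iso (std_ext M R a b c d) X f g)"

text \<open>Composing with the given isomorphisms and their inverses moves the question to the
  twisted products. There both conditions amount to the existence of \<open>p\<close> and
  \<open>q\<close> as in \<open>cohomologous_via\<close>.\<close>

lemma realises_iso_iff:
  assumes X: "X \<in> extensions M R" "realises F X" and X': "X' \<in> extensions M R" "realises F' X'"
  shows "isomorphic_ext X X' \<longleftrightarrow> (\<lambda>zs. F zs - F' zs) \<in> delta_MPL M R 1 ` cochains M R 1"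
proof -
  obtain a b c d f g where abcd: "cochain_maps a b c d" "cocycle_maps a b c d" "F = cochain2 a b c d"
    and fg: "ext_iso (std_ext M R a b c d) X f g"
    using X(2) unfolding realises_def by blast
  obtain a' b' c' d' f' g' where abcd': "cochain_maps a' b' c' d'" "cocycle_maps a' b' c' d'"
      "F' = cochain2 a' b' c' d'" and fg': "ext_iso (std_ext M R a' b' c' d') X' f' g'"
    using X'(2) unfolding realises_def by blast
  note S = std_ext_in_extensions[OF abcd(1,2)] std_ext_in_extensions[OF abcd'(1,2)]
  have "isomorphic_ext X X' \<longleftrightarrow>
      (\<exists>f g. ext_iso (std_ext M R a b c d) (std_ext M R a' b' c' d') f g)"
    unfolding isomorphic_ext_iff
    using ext_iso_comp fg fg' ext_iso_sym[OF fg S(1)] ext_iso_sym[OF fg' S(2)] by meson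
  then show ?thesis
    unfolding abcd(3) abcd'(3) coboundary_iff[OF abcd(1) abcd'(1)] std_ext_iso_iff[OF abcd(1) abcd'(1)] .
qed

end

theorem theorem5p6:
  fixes M :: "('k::field_char_0, 'g::ab_group_add, 'h::ab_group_add) matched_pair_data"
    and R :: "('k, 'g, 'h, 'v::ab_group_add, 'w::ab_group_add) mp_rep_data"
  assumes "on_type (mpG M)" and "on_type (mpH M)"
    and "matched_pair M"
    and "mp_rep M R"
    and "\<exists>\<phi>::'g \<times> 'v \<Rightarrow> 'a. inj \<phi>"
    and "\<exists>\<chi>::'h \<times> 'w \<Rightarrow> 'b. inj \<chi>"
  shows "\<exists>\<Phi>. bij_betw \<Phi> (Ext M R :: ('k, 'a, 'b, 'g, 'h, 'v, 'w) extension_data set set) (H2_MPL M R)"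
proof -
  interpret mp_rep_on_type M R by unfold_locales (fact assms)+
  obtain \<phi> :: "'g \<times> 'v \<Rightarrow> 'a" and \<chi> :: "'h \<times> 'w \<Rightarrow> 'b" where inj: "inj \<phi>" "inj \<chi>"
    using assms(5,6) by blast
  have bij: "bij_betw (inv \<phi>) (range \<phi>) UNIV" "bij_betw (inv \<chi>) (range \<chi>) UNIV"
    using inj by (auto intro: inj_imp_bij_betw_inv)
  show ?thesis
    unfolding Ext_def H2_MPL_def
  proof (rule quotient_bij_betw_of_relation[where P = realises, OF equiv_isomorphic_ext])
    fix X :: "('k, 'a, 'b, 'g, 'h, 'v, 'w) extension_data"
    assume "X \<in> extensions M R"
    then show "\<exists>F\<in>cocycles2 M R. realises F X"
      using extension_iso_std_ext unfolding realises_def Bex_def cocycles2_iff by metis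
  next
    fix F assume "F \<in> cocycles2 M R"
    then obtain a b c d where abcd: "cochain_maps a b c d" "cocycle_maps a b c d" "F = cochain2 a b c d"
      unfolding cocycles2_iff by blast
    \<comment> \<open>The injections supply the carriers: the twisted product is copied onto
      \<open>range \<phi>\<close> and \<open>range \<chi>\<close>, along the inverses of
      \<open>\<phi>\<close> and \<open>\<chi>\<close>.\<close>
    let ?X = "pull_ext (range \<phi>) (inv \<phi>) (range \<chi>) (inv \<chi>) (std_ext M R a b c d)"
    have X: "?X \<in> extensions M R" "ext_iso ?X (std_ext M R a b c d) (inv \<phi>) (inv \<chi>)"
      using pull_ext_extensions[OF std_ext_in_extensions[OF abcd(1,2)], of "inv \<phi>" "range \<phi>" "inv \<chi>" "range \<chi>"] bij
      by simp_all
    have "realises F ?X"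
      \<comment> \<open>The isomorphism is inverted because \<open>realises\<close> asks for one
        that starts at the twisted product.\<close>
      unfolding realises_def using ext_iso_sym[OF X(2,1)] abcd by metis
    then show "\<exists>X\<in>(extensions M R :: ('k, 'a, 'b, 'g, 'h, 'v, 'w) extension_data set). realises F X"
      using X(1) by (rule bexI)
  next
    fix X X' :: "('k, 'a, 'b, 'g, 'h, 'v, 'w) extension_data" and F F'
    assume "X \<in> extensions M R" "X' \<in> extensions M R" "F \<in> cocycles2 M R" "F' \<in> cocycles2 M R"
      "realises F X" "realises F' X'"
    then show "(X, X') \<in> {(X, Y). X \<in> extensions M R \<and> Y \<in> extensions M R \<and> isomorphic_ext X Y} \<longleftrightarrow>
        (F, F') \<in> {(F, F'). F \<in> cocycles2 M R \<and> F' \<in> cocycles2 M R \<and>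
          (\<lambda>zs. F zs - F' zs) \<in> delta_MPL M R 1 ` cochains M R 1}"
      using realises_iso_iff[of X F X' F'] by (simp del: One_nat_def)
  qed auto
qed

end
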